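(* There is an algorithm $\mathbb R$ that, on input a graph $G$, an integer $k\ge 1$, and a prime power $q$, computes a graph $H=H(G,k,q)$ such that: (R1) if $G$ has a $k$-clique, then $H$ has a clique of size $q^k$; (R2) if $G$ does not have a $k$-clique, then $H$ has no clique of size $q^{k-1}+1$. Moreover, $\mathbb R$ runs in time polynomial in $|V(G)|+q^k$.
   Context: A $k$-clique in a graph is a set of $k$ pairwise adjacent vertices. *)

theory Defs
  imports
    "HOL-Library.Ramsey"
    "HOL-Library.Log_Nat"
    "HOL-Computational_Algebra.Polynomial"
    "HOL-Number_Theory.Prime_Powers"
begin

section \<open>Graphs and cliques\<close>

text \<open>
  Graphs are the inputs and outputs of an algorithm, so their vertices are numbered: the pair
  \<open>(n, E)\<close> is the graph with vertex set \<open>{..<n}\<close> and edge set \<open>E\<close>, where an edge is a two-element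
  set of vertices. In particular there are no loops.
\<close>

type_synonym graph = "nat \<times> nat set set"

definition verts :: "graph \<Rightarrow> nat set" where
  "verts G = {..<fst G}"

definition edges :: "graph \<Rightarrow> nat set set" where
  "edges G = snd G"

definition is_graph :: "graph \<Rightarrow> bool" where
  "is_graph G \<longleftrightarrow> edges G \<subseteq> nsets (verts G) 2"

definition has_clique :: "graph \<Rightarrow> nat \<Rightarrow> bool" where
  "has_clique G r \<longleftrightarrow> (\<exists>C. C \<subseteq> verts G \<and> card C = r \<and> clique C (edges G))"


section \<open>Algorithms and their running time\<close>

text \<open>
  Algorithms are programs of a deterministic random access machine in structured form. The memory
  consists of named arrays of unbounded length, whose cells hold natural numbers of unbounded
  size; scalar variables are cells with index 0. A program mentions only finitely many array names
  explicitly, while indices are computed at run time. Subtraction is truncated, and division is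
  integer division with \<open>x div 0 = 0\<close>.

  Time is measured by the logarithmic cost criterion: evaluating an expression costs the sum of
  the bit lengths of the values of all its subexpressions (array indices included). Running times
  are thus polynomially related to those of Turing machines, although multiplication and division
  are primitive operations.
\<close>

type_synonym state = "string \<Rightarrow> nat \<Rightarrow> nat"

datatype aexp =
    Num nat
  | Get string aexp
  | Add aexp aexp
  | Sub aexp aexp
  | Mul aexp aexp
  | Div aexp aexp

datatype com =
    Skip
  | Assign string aexp aexp
  | Seq com com
  | IfNZ aexp com com
  | WhileNZ aexp com

fun val :: "state \<Rightarrow> aexp \<Rightarrow> nat" where
  "val s (Num n) = n"
| "val s (Get x a) = s x (val s a)"
| "val s (Add a b) = val s a + val s b"
| "val s (Sub a b) = val s a - val s b"
| "val s (Mul a b) = val s a * val s b"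
| "val s (Div a b) = val s a div val s b"

definition len :: "nat \<Rightarrow> nat" where
  "len n = Suc (floorlog 2 n)"

fun cost :: "state \<Rightarrow> aexp \<Rightarrow> nat" where
  "cost s (Num n) = len n"
| "cost s (Get x a) = cost s a + len (val s (Get x a))"
| "cost s (Add a b) = cost s a + cost s b + len (val s (Add a b))"
| "cost s (Sub a b) = cost s a + cost s b + len (val s (Sub a b))"
| "cost s (Mul a b) = cost s a + cost s b + len (val s (Mul a b))"
| "cost s (Div a b) = cost s a + cost s b + len (val s (Div a b))"

text \<open>
  \<open>exec c s t s'\<close>: started in state \<open>s\<close>, the program \<open>c\<close> halts in state \<open>s'\<close> after time \<open>t\<close>.
  \<open>Assign x a e\<close> stores the value of \<open>e\<close> in the cell of array \<open>x\<close> whose index is the value of \<open>a\<close>.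
\<close>

inductive exec :: "com \<Rightarrow> state \<Rightarrow> nat \<Rightarrow> state \<Rightarrow> bool" where
  Skip: "exec Skip s 1 s"
| Assign: "exec (Assign x a e) s (cost s a + cost s e) (s(x := (s x)(val s a := val s e)))"
| Seq: "exec c1 s1 t1 s2 \<Longrightarrow> exec c2 s2 t2 s3 \<Longrightarrow> exec (Seq c1 c2) s1 (t1 + t2) s3"
| IfTrue: "val s b \<noteq> 0 \<Longrightarrow> exec c1 s t s' \<Longrightarrow> exec (IfNZ b c1 c2) s (cost s b + t) s'"
| IfFalse: "val s b = 0 \<Longrightarrow> exec c2 s t s' \<Longrightarrow> exec (IfNZ b c1 c2) s (cost s b + t) s'"
| WhileFalse: "val s b = 0 \<Longrightarrow> exec (WhileNZ b c) s (cost s b) s"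
| WhileTrue: "val s1 b \<noteq> 0 \<Longrightarrow> exec c s1 t1 s2 \<Longrightarrow> exec (WhileNZ b c) s2 t2 s3 \<Longrightarrow>
    exec (WhileNZ b c) s1 (cost s1 b + t1 + t2) s3"

inductive_cases exec_SkipE: "exec Skip s t s'"
  and exec_AssignE: "exec (Assign x a e) s t s'"
  and exec_SeqE: "exec (Seq c1 c2) s t s'"
  and exec_IfNZE: "exec (IfNZ b c1 c2) s t s'"
  and exec_WhileNZE: "exec (WhileNZ b c) s t s'"

lemma exec_deterministic:
  "exec c s t s' \<Longrightarrow> exec c s u s'' \<Longrightarrow> u = t \<and> s'' = s'"
proof (induction arbitrary: u s'' rule: exec.induct)
  case (Skip s)
  then show ?case by (rule exec_SkipE) simp
next
  case (Assign x a e s)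
  then show ?case by (rule exec_AssignE) simp
next
  case (Seq c1 s1 t1 s2 c2 t2 s3)
  from Seq.prems obtain u1 r u2
    where "exec c1 s1 u1 r" "exec c2 r u2 s''" "u = u1 + u2"
    by (rule exec_SeqE)
  with Seq.IH show ?case by blast
next
  case (IfTrue s b c1 t s' c2)
  from IfTrue.prems IfTrue.hyps(1) obtain v where "exec c1 s v s''" "u = cost s b + v"
    by (auto elim: exec_IfNZE)
  with IfTrue.IH show ?case by blast
next
  case (IfFalse s b c2 t s' c1)
  from IfFalse.prems IfFalse.hyps(1) obtain v where "exec c2 s v s''" "u = cost s b + v"
    by (auto elim: exec_IfNZE)
  with IfFalse.IH show ?case by blast
next
  case (WhileFalse s b c)
  from WhileFalse.prems show ?case by (rule exec_WhileNZE) (use WhileFalse.hyps in auto)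
next
  case (WhileTrue s1 b c t1 s2 t2 s3)
  from WhileTrue.prems WhileTrue.hyps(1) obtain u1 r u2
    where "exec c s1 u1 r" "exec (WhileNZ b c) r u2 s''" "u = cost s1 b + u1 + u2"
    by (auto elim: exec_WhileNZE)
  with WhileTrue.IH show ?case by blast
qed


section \<open>Input and output\<close>

text \<open>
  A graph on \<open>n\<close> vertices is given by \<open>n\<close> and its adjacency matrix, stored row by row. The entries
  are 2 for adjacent and 1 for non-adjacent vertices. Since blank cells hold 0, an output matrix
  has to be written entry by entry, so that a time bound also bounds the size of the output.
\<close>

definition matrix :: "graph \<Rightarrow> nat \<Rightarrow> nat" where
  "matrix G i = (if {i div fst G, i mod fst G} \<in> edges G then 2 else 1)"

definition input :: "graph \<Rightarrow> nat \<Rightarrow> nat \<Rightarrow> state" where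
  "input G k q = (\<lambda>x i.
     if x = ''n'' \<and> i = 0 then fst G
     else if x = ''G'' \<and> i < fst G * fst G then matrix G i
     else if x = ''k'' \<and> i = 0 then k
     else if x = ''q'' \<and> i = 0 then q
     else 0)"

definition outputs :: "state \<Rightarrow> graph \<Rightarrow> bool" where
  "outputs s H \<longleftrightarrow> s ''m'' 0 = fst H \<and> (\<forall>i < fst H * fst H. s ''H'' i = matrix H i)"

end

theory Submission
  imports Defs
begin

text \<open>
  The vertices of \<open>H\<close> are pairs of a point \<open>x \<in> [q]\<^sup>k\<close> and a number \<open>u\<close>; the intended
  clique for a \<open>k\<close>-clique \<open>v\<close> of \<open>G\<close> consists of the pairs with \<open>u = (\<Sum>i<k. x\<^sub>i s(i, v\<^sub>i))\<close>,
  one for each \<open>x\<close>. The numbers \<open>s(i, w)\<close> are polynomially bounded, but any 15 of them are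
  linearly independent over coefficients of size at most \<open>q\<close>, by a Vandermonde argument. Two pairs
  are adjacent if their points differ in more than 5 coordinates, or if they differ in 1 to 5
  coordinates and the two values of \<open>u\<close> are explained by a choice of vertices of \<open>G\<close> for these
  coordinates; if exactly two coordinates differ, these two vertices must be adjacent in \<open>G\<close>.

  For soundness, let \<open>A \<subseteq> [q]\<^sup>k\<close> be the points of a clique of \<open>H\<close>. By independence, the vertices
  explaining nearby pairs of points agree, so every \<open>x \<in> A\<close> sees a vertex \<open>v\<^sub>i\<close> for each coordinate
  \<open>i\<close> in which some point of \<open>A\<close> at distance at most 2 differs from \<open>x\<close>. If some coordinate is not
  seen, take the axis-parallel line through \<open>x\<close> in that direction. Otherwise, if \<open>G\<close> has no
  \<open>k\<close>-clique, some \<open>v\<^sub>i\<close> and \<open>v\<^sub>j\<close> are not adjacent, so \<open>A\<close> meets the plane through \<open>x\<close> in directions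
  \<open>i\<close> and \<open>j\<close> in a subset of a line, and we take the line through \<open>x\<close> in the other direction. All
  these lines are pairwise disjoint and have \<open>q\<close> points each, hence \<open>|A| q \<le> q\<^sup>k\<close>.
\<close>

section \<open>Disjoint lines\<close>

definition dset :: "nat \<Rightarrow> (nat \<Rightarrow> nat) \<Rightarrow> (nat \<Rightarrow> nat) \<Rightarrow> nat set" where
  "dset k x y = {i. i < k \<and> x i \<noteq> y i}"

lemma dset_iff: "i \<in> dset k x y \<longleftrightarrow> i < k \<and> x i \<noteq> y i"
  by (simp add: dset_def)

lemma finite_dset [simp]: "finite (dset k x y)"
  by (simp add: dset_def)

lemma dset_commute: "dset k x y = dset k y x"
  by (auto simp: dset_def)

lemma dset_triangle: "dset k x z \<subseteq> dset k x y \<union> dset k y z"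
  by (auto simp: dset_def)

lemma card_dset_le:
  assumes "dset k x y \<subseteq> X \<union> Y" "finite X" "finite Y" "card X \<le> a" "card Y \<le> b"
  shows "card (dset k x y) \<le> a + b"
  by (meson add_mono assms card_Un_le card_mono finite_UnI le_trans)

lemma card_dset_triangle:
  assumes "card (dset k x y) \<le> a" "card (dset k y z) \<le> b"
  shows "card (dset k x z) \<le> a + b"
  using card_dset_le[OF dset_triangle] assms by simp

text \<open>Separates the combinatorics from the arithmetic that produces \<open>w\<close>, where
  \<open>w x y i\<close> is the vertex that a close pair proposes for a coordinate in which it
  differs. If no labelling is a clique, the disjoint lines through the points of \<open>A\<close>
  give \<open>card A * q \<le> q ^ k\<close>, contradicting \<open>large\<close>.\<close>

lemma consistent_labels_give_clique:
  fixes w :: "(nat \<Rightarrow> nat) \<Rightarrow> (nat \<Rightarrow> nat) \<Rightarrow> nat \<Rightarrow> 'v"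
  assumes A: "A \<subseteq> PiE {..<k} (\<lambda>_. {..<q})" and k: "k \<ge> 1" and q: "q \<ge> 1"
    and w_in: "\<And>x y i. x \<in> A \<Longrightarrow> y \<in> A \<Longrightarrow> card (dset k x y) \<le> 5 \<Longrightarrow> i \<in> dset k x y \<Longrightarrow> w x y i \<in> W"
    and w_sym: "\<And>x y i. x \<in> A \<Longrightarrow> y \<in> A \<Longrightarrow> card (dset k x y) \<le> 5 \<Longrightarrow> i \<in> dset k x y \<Longrightarrow>
      w x y i = w y x i"
    and w_eq: "\<And>x y z i. x \<in> A \<Longrightarrow> y \<in> A \<Longrightarrow> z \<in> A \<Longrightarrow> card (dset k x y) \<le> 5 \<Longrightarrow>
      card (dset k x z) \<le> 5 \<Longrightarrow> card (dset k y z) \<le> 5 \<Longrightarrow> i \<in> dset k x y \<Longrightarrow> i \<in> dset k x z \<Longrightarrow>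
      w x y i = w x z i"
    and edge: "\<And>x y i j. x \<in> A \<Longrightarrow> y \<in> A \<Longrightarrow> dset k x y = {i, j} \<Longrightarrow> i \<noteq> j \<Longrightarrow>
      {w x y i, w x y j} \<in> E"
    and large: "card A > q ^ (k - 1)"
  shows "\<exists>v \<in> {..<k} \<rightarrow> W. \<forall>i<k. \<forall>j<k. i \<noteq> j \<longrightarrow> {v i, v j} \<in> E"
proof (rule ccontr)
  assume "\<not> ?thesis"
  then have "\<forall>v. \<exists>p. v \<in> {..<k} \<rightarrow> W \<longrightarrow>
      fst p < k \<and> snd p < k \<and> fst p \<noteq> snd p \<and> {v (fst p), v (snd p)} \<notin> E"
    by (metis fst_conv snd_conv)
  \<comment> \<open>The bad pair is chosen as a function of the labelling alone, so that points with
    equal labels later pick the same two directions.\<close>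
  then obtain p where p: "\<And>v. v \<in> {..<k} \<rightarrow> W \<Longrightarrow>
      fst (p v) < k \<and> snd (p v) < k \<and> fst (p v) \<noteq> snd (p v) \<and> {v (fst (p v)), v (snd (p v))} \<notin> E"
    by metis
  define near where "near x = {y \<in> A. card (dset k x y) \<le> 2}" for x
  define full where "full x \<longleftrightarrow> (\<forall>i<k. \<exists>y\<in>near x. i \<in> dset k x y)" for x
  define nb where "nb x i = (SOME y. y \<in> near x \<and> i \<in> dset k x y)" for x i
  define l where "l x = restrict (\<lambda>i. w x (nb x i) i) {..<k}" for x
  have nb: "nb x i \<in> near x" "i \<in> dset k x (nb x i)" if "full x" "i < k" for x i
  proof -
    have "\<exists>y. y \<in> near x \<and> i \<in> dset k x y"
      using that by (auto simp: full_def)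
    from someI_ex[OF this] show "nb x i \<in> near x" "i \<in> dset k x (nb x i)"
      by (simp_all add: nb_def)
  qed
  have l_near: "l x i = w x y i" if x: "x \<in> A" "full x" and y: "y \<in> near x" "i \<in> dset k x y" for x y i
  proof -
    have i: "i < k" using y by (simp add: dset_iff)
    note n = nb[OF x(2) i]
    have "card (dset k y (nb x i)) \<le> 2 + 2"
      using card_dset_triangle[of k y x 2 "nb x i" 2] y n by (simp add: near_def dset_commute)
    then have "w x (nb x i) i = w x y i"
      using x y n by (intro w_eq) (auto simp: near_def dset_commute)
    with i show ?thesis by (simp add: l_def)
  qed
  have l_in: "l x \<in> {..<k} \<rightarrow> W" if x: "x \<in> A" "full x" for x
  proof -
    have "w x (nb x i) i \<in> W" if "i < k" for i
      using nb[OF x(2) that] x(1) by (intro w_in) (auto simp: near_def)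
    then show ?thesis by (auto simp: l_def)
  qed
  have l_eq: "l x = l y" if x: "x \<in> A" "full x" and y: "y \<in> A" "full y" "y \<in> near x" for x y
  proof
    fix i
    show "l x i = l y i"
    proof (cases "i < k")
      case True
      define x' y' where "x' = nb x i" and "y' = nb y i"
      have x': "x' \<in> A" "card (dset k x x') \<le> 2" "i \<in> dset k x x'"
        using nb[OF x(2) True] by (auto simp: x'_def near_def)
      have y': "y' \<in> A" "card (dset k y y') \<le> 2" "i \<in> dset k y y'"
        using nb[OF y(2) True] by (auto simp: y'_def near_def)
      have xy: "card (dset k x y) \<le> 2" using y by (simp add: near_def)
      have c1: "card (dset k x' y) \<le> 2 + 2"
        using card_dset_triangle[of k x' x 2 y 2] xy x' by (simp add: dset_commute)
      have c2: "card (dset k x y') \<le> 2 + 2"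
        using card_dset_triangle[of k x y 2 y' 2] xy y' by simp
      have l: "l x i = w x x' i" "l y i = w y y' i"
        using True by (simp_all add: l_def x'_def y'_def)
      show ?thesis
      proof (cases "x i = y i")
        case False
        then have "i \<in> dset k x y" using True by (simp add: dset_iff)
        moreover from this have "w x x' i = w x y i"
          using x y x' xy c1 by (intro w_eq) auto
        moreover have "w x y i = w y x i"
          using x y xy calculation by (intro w_sym) auto
        moreover have "w y x i = w y y' i"
          using x y y' xy c2 calculation by (intro w_eq) (auto simp: dset_commute)
        ultimately show ?thesis using l by simp
      next
        case eq: True
        have i: "i \<in> dset k x y'" using y' eq by (simp add: dset_iff)
        \<comment> \<open>The path from \<open>x'\<close> through \<open>x\<close> and
          \<open>y\<close> to \<open>y'\<close> may have length 6, but \<open>i\<close> occurs in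
          both end segments and is counted only once. This is where the distance bound 5 comes
          from.\<close>
        have "dset k x' y' \<subseteq> (dset k x y \<union> (dset k x x' - {i})) \<union> dset k y y'"
          using y'(3) by (auto simp: dset_iff)
        moreover have "card (dset k x y \<union> (dset k x x' - {i})) \<le> 2 + 1"
          using xy x'(2,3) by (intro order.trans[OF card_Un_le] add_mono) auto
        ultimately have "card (dset k x' y') \<le> (2 + 1) + 2"
          using y'(2) by (intro card_dset_le) auto
        then have "w x x' i = w x y' i"
          using x x' y' c2 i by (intro w_eq) auto
        also have "\<dots> = w y' x i"
          using x y' c2 i by (intro w_sym) auto
        also have "\<dots> = w y' y i"
          using x y y' c2 i xy by (intro w_eq) (auto simp: dset_commute)
        also have "\<dots> = w y y' i"
          using y y' by (intro w_sym) (auto simp: dset_commute)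
        finally show ?thesis using l by simp
      qed
    qed (simp add: l_def)
  qed
  define i j where "i x = fst (p (l x))" and "j x = snd (p (l x))" for x
  have ij: "i x < k" "j x < k" "i x \<noteq> j x" "{l x (i x), l x (j x)} \<notin> E" if "x \<in> A" "full x" for x
    using p[OF l_in[OF that]] by (simp_all add: i_def j_def)
  have card2: "card S \<le> 2" if "S \<subseteq> {a, b :: nat}" for S a b
    using card_mono[OF _ that] by (simp add: card_insert_if split: if_splits)
  \<comment> \<open>In the plane through \<open>x\<close> spanned by its bad directions, two points
    of \<open>A\<close> differing in both directions would carry the labels of \<open>x\<close>, and
    \<open>edge\<close> would make these labels adjacent.\<close>
  have no_diag: "dset k y z \<noteq> {i x, j x}"
    if x: "x \<in> A" "full x" and y: "y \<in> A" "dset k x y \<subseteq> {i x, j x}"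
      and z: "z \<in> A" "dset k x z \<subseteq> {i x, j x}" for x y z
  proof
    assume d: "dset k y z = {i x, j x}"
    have c: "card (dset k x y) \<le> 2" "card (dset k x z) \<le> 2" "card (dset k y z) \<le> 2"
      using card2[OF y(2)] card2[OF z(2)] card2[OF equalityD1[OF d]] by auto
    have "l x h = w y z h" if h: "h \<in> dset k y z" for h
    proof (cases "x h = y h")
      case False
      then have hx: "h \<in> dset k x y" using h by (simp add: dset_iff)
      then have "l x h = w x y h" using x y c by (intro l_near) (auto simp: near_def)
      also have "\<dots> = w y x h" using x y c hx by (intro w_sym) auto
      also have "\<dots> = w y z h" using x y z c hx h by (intro w_eq) (auto simp: dset_commute)
      finally show ?thesis .
    next
      case True
      then have hx: "h \<in> dset k x z" using h by (simp add: dset_iff)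
      then have "l x h = w x z h" using x z c by (intro l_near) (auto simp: near_def)
      also have "\<dots> = w z x h" using x z c hx by (intro w_sym) auto
      also have "\<dots> = w z y h" using x y z c hx h by (intro w_eq) (auto simp: dset_commute)
      also have "\<dots> = w y z h" using y z c h by (intro w_sym) (auto simp: dset_commute)
      finally show ?thesis .
    qed
    then show False using edge[OF y(1) z(1) d ij(3)[OF x]] ij(4)[OF x] d by simp
  qed
  \<comment> \<open>the direction of the line through \<open>x\<close>\<close>
  define d where "d x =
    (if full x then
       if \<exists>y\<in>A. dset k x y \<subseteq> {i x, j x} \<and> x (i x) \<noteq> y (i x) then j x else i x
     else SOME h. h < k \<and> (\<forall>y\<in>near x. h \<notin> dset k x y))" for x
  have d_full: "d x < k" "d x \<in> {i x, j x}" if "x \<in> A" "full x" for x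
    using that ij[OF that] by (auto simp: d_def)
  \<comment> \<open>By \<open>no_diag\<close>, the points of \<open>A\<close> in this plane all lie
    on one axis-parallel line through \<open>x\<close>, and \<open>d x\<close> is the direction
    across it.\<close>
  have d_full_eq: "x (d x) = y (d x)"
    if x: "x \<in> A" "full x" and y: "y \<in> A" "dset k x y \<subseteq> {i x, j x}" for x y
  proof (cases "\<exists>y\<in>A. dset k x y \<subseteq> {i x, j x} \<and> x (i x) \<noteq> y (i x)")
    case True
    then obtain z where z: "z \<in> A" "dset k x z \<subseteq> {i x, j x}" "x (i x) \<noteq> z (i x)" by blast
    have dx: "d x = j x" using True x by (simp add: d_def)
    note ijx = ij[OF x]
    have zj: "x (j x) = z (j x)"
    proof (rule ccontr)
      assume "x (j x) \<noteq> z (j x)"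
      then have "dset k x z = {i x, j x}" using z ijx by (auto simp: dset_def)
      then show False using no_diag[OF x x(1) _ z(1,2)] by (simp add: dset_def)
    qed
    show ?thesis
    proof (rule ccontr)
      assume "x (d x) \<noteq> y (d x)"
      then have n: "x (j x) \<noteq> y (j x)" by (simp add: dx)
      have "x (i x) = y (i x)"
      proof (rule ccontr)
        assume "x (i x) \<noteq> y (i x)"
        then have "dset k x y = {i x, j x}" using y n ijx by (auto simp: dset_def)
        then show False using no_diag[OF x x(1) _ y] by (simp add: dset_def)
      qed
      moreover have "dset k y z \<subseteq> {i x, j x}"
        using dset_triangle[of k y z x] y z by (auto simp: dset_commute)
      ultimately have "dset k y z = {i x, j x}"
        using z n zj ijx by (auto simp: dset_def)
      then show False using no_diag[OF x y z(1,2)] by simp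
    qed
  next
    case False
    then have "d x = i x" using x(2) unfolding d_def by (simp only: if_True if_False)
    then show ?thesis using False y by metis
  qed
  have d_sparse: "d x < k" "\<And>y. y \<in> near x \<Longrightarrow> d x \<notin> dset k x y" if "\<not> full x" for x
  proof -
    have "\<exists>h. h < k \<and> (\<forall>y\<in>near x. h \<notin> dset k x y)"
      using that by (auto simp: full_def)
    from someI_ex[OF this] that show "d x < k" "\<And>y. y \<in> near x \<Longrightarrow> d x \<notin> dset k x y"
      by (simp_all add: d_def)
  qed
  have d_less: "d x < k" if "x \<in> A" for x
    using that d_full d_sparse by blast
  \<comment> \<open>Base points of lines that meet differ at most in \<open>d x\<close> and
    \<open>d y\<close>, so each is near the other. If both are full, \<open>l_eq\<close> gives them
    the same two directions; a point that is not full has no near point differing in its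
    direction.\<close>
  have lines_disjoint: "x = y" if x: "x \<in> A" and y: "y \<in> A" and s: "dset k x y \<subseteq> {d x, d y}" for x y
  proof -
    have c: "card (dset k x y) \<le> 2" using card2[OF s] .
    have near: "y \<in> near x" "x \<in> near y" using c x y by (simp_all add: near_def dset_commute)
    have nd: "d x \<notin> dset k x y \<and> d y \<notin> dset k x y"
    proof (cases "full x")
      case fx: True
      show ?thesis
      proof (cases "full y")
        case fy: True
        have "l x = l y" using l_eq x y fx fy near by blast
        then have e: "i x = i y" "j x = j y" by (simp_all add: i_def j_def)
        then have "dset k x y \<subseteq> {i x, j x}"
          using s d_full[OF x fx] d_full[OF y fy] by auto
        then have "x (d x) = y (d x)" "y (d y) = x (d y)"
          using d_full_eq[OF x fx y] d_full_eq[OF y fy x] e by (simp_all add: dset_commute)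
        then show ?thesis by (simp add: dset_iff)
      next
        case fy: False
        have dy: "d y \<notin> dset k x y" using d_sparse(2)[OF fy near(2)] by (simp add: dset_commute)
        then have "dset k x y \<subseteq> {i x, j x}" using s d_full[OF x fx] by auto
        then show ?thesis using dy d_full_eq[OF x fx y] by (simp add: dset_iff)
      qed
    next
      case fx: False
      have dx: "d x \<notin> dset k x y" using d_sparse(2)[OF fx near(1)] .
      show ?thesis
      proof (cases "full y")
        case fy: True
        have "dset k y x \<subseteq> {i y, j y}" using dx s d_full[OF y fy] by (auto simp: dset_commute)
        then show ?thesis using dx d_full_eq[OF y fy x] by (simp add: dset_iff)
      next
        case fy: False
        then show ?thesis using dx d_sparse(2)[OF fy near(2)] by (simp add: dset_commute)
      qed
    qed
    with s have "dset k x y = {}" by blast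
    then have "\<forall>h<k. x h = y h" by (auto simp: dset_def)
    moreover have "x \<in> extensional {..<k}" "y \<in> extensional {..<k}" using A x y by (auto simp: PiE_def)
    ultimately show "x = y" by (intro extensionalityI) auto
  qed
  \<comment> \<open>Enumerates the points of all lines; injectivity says that the lines are
    disjoint.\<close>
  let ?f = "\<lambda>(x, c). x(d x := c)"
  have "inj_on ?f (A \<times> {..<q})"
  proof (rule inj_onI, clarify)
    fix x c y c' assume x: "x \<in> A" and y: "y \<in> A" and e: "x(d x := c) = y(d y := c')"
    have "x h = y h" if "h \<notin> {d x, d y}" for h
      using fun_cong[OF e, of h] that by simp
    then have "dset k x y \<subseteq> {d x, d y}" unfolding dset_def by blast
    then have "x = y" by (rule lines_disjoint[OF x y])
    then show "x = y \<and> c = c'" using fun_cong[OF e, of "d x"] by simp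
  qed
  moreover have "?f ` (A \<times> {..<q}) \<subseteq> PiE {..<k} (\<lambda>_. {..<q})"
    using A d_less by (fastforce simp: PiE_iff extensional_def)
  ultimately have "card (A \<times> {..<q}) \<le> card (PiE {..<k} (\<lambda>_. {..<q}))"
    by (intro card_inj_on_le) (auto intro: finite_PiE)
  then have "card A * q \<le> q ^ k"
    by (simp add: card_cartesian_product card_PiE)
  also have "q ^ k = q ^ (k - 1) * q"
    using k by (metis One_nat_def Suc_pred less_eq_Suc_le power_Suc2)
  finally show False using large q by simp
qed

section \<open>Independent numbers\<close>

text \<open>The lowest digit is a multiple of \<open>B\<close> smaller than \<open>B\<close> in
  absolute value, hence 0; dividing by \<open>B\<close> leaves a shorter expansion.\<close>

lemma small_digits_eq_0:
  fixes a :: "nat \<Rightarrow> int"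
  assumes "(\<Sum>t<T. a t * B ^ t) = 0" "\<And>t. t < T \<Longrightarrow> \<bar>a t\<bar> < B" "t < T"
  shows "a t = 0"
  using assms
proof (induction T arbitrary: a t)
  case (Suc T)
  have B: "B > 0" using Suc.prems(2)[of 0] by linarith
  have e: "a 0 + B * (\<Sum>t<T. a (Suc t) * B ^ t) = 0"
    using Suc.prems(1) by (simp add: sum.lessThan_Suc_shift sum_distrib_left mult_ac del: sum.lessThan_Suc)
  then have "B dvd a 0" by (metis dvd_add_left_iff dvd_0_right dvd_triv_left)
  then have a0: "a 0 = 0" using Suc.prems(2)[of 0] B dvd_imp_le_int[of "a 0" B] by fastforce
  with e B have "(\<Sum>t<T. a (Suc t) * B ^ t) = 0" by simp
  then have "a (Suc t) = 0" if "t < T" for t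
    using Suc.IH[of "\<lambda>t. a (Suc t)" t] Suc.prems(2) that by simp
  with a0 Suc.prems(3) show ?case by (cases t) auto
qed simp

text \<open>The Vandermonde argument in polynomial form: combine the moments with the coefficients
  of a polynomial that vanishes at every node except \<open>r\<close>. Nodes may coincide, so only
  the total coefficient at a node is determined.\<close>

lemma moments_eq_0:
  fixes c :: "'j \<Rightarrow> int" and p :: "'j \<Rightarrow> int"
  assumes fin: "finite J" and card: "card J \<le> T"
    and mom: "\<And>t. t < T \<Longrightarrow> (\<Sum>j\<in>J. c j * p j ^ t) = 0"
  shows "(\<Sum>j | j \<in> J \<and> p j = r. c j) = 0"
proof (cases "r \<in> p ` J")
  case True
  define f where "f = (\<Prod>s\<in>p ` J - {r}. [:- s, 1:])"
  have "degree f \<le> (\<Sum>s\<in>p ` J - {r}. degree [:- s, 1:])"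
    unfolding f_def using fin by (intro order.trans[OF degree_prod_sum_le]) auto
  also have "\<dots> = card (p ` J - {r})" by simp
  also have "\<dots> < card (p ` J)" using fin True by (intro card_Diff1_less) auto
  also have "\<dots> \<le> T" using card card_image_le[OF fin, of p] by linarith
  finally have deg: "degree f < T" .
  have "0 = (\<Sum>t\<le>degree f. coeff f t * (\<Sum>j\<in>J. c j * p j ^ t))"
    using mom deg by (auto intro!: sum.neutral[symmetric])
  also have "\<dots> = (\<Sum>j\<in>J. c j * poly f (p j))"
    by (simp add: poly_altdef sum_distrib_left sum.swap[of _ J] mult_ac)
  also have "\<dots> = (\<Sum>j | j \<in> J \<and> p j = r. c j * poly f (p j))"
    using fin by (intro sum.mono_neutral_right) (auto simp: f_def poly_prod)
  also have "\<dots> = poly f r * (\<Sum>j | j \<in> J \<and> p j = r. c j)"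
    by (simp add: sum_distrib_left mult.commute)
  finally have "poly f r * (\<Sum>j | j \<in> J \<and> p j = r. c j) = 0" by simp
  moreover have "poly f r \<noteq> 0" using fin by (auto simp: f_def poly_prod)
  ultimately show ?thesis by simp
qed (auto intro!: sum.neutral)

text \<open>The point \<open>(1, p, ..., p^14)\<close> of the moment curve, packed into one number
  in base \<open>M\<close>. Fifteen moments suffice for three pairs of points with at most five
  differing coordinates each.\<close>

definition sidon :: "nat \<Rightarrow> nat \<Rightarrow> nat" where
  "sidon M p = (\<Sum>t<15. (M * p) ^ t)"

text \<open>Collecting powers of \<open>M\<close> gives an expansion of 0 whose digits are the
  moments \<open>a t\<close>. They are smaller than \<open>M\<close> in absolute value, so each
  vanishes and \<open>moments_eq_0\<close> applies.\<close>

lemma sidon_independent: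
  fixes c :: "'j \<Rightarrow> int" and p :: "'j \<Rightarrow> nat"
  assumes fin: "finite J" and card: "card J \<le> 15"
    and c: "\<And>j. j \<in> J \<Longrightarrow> \<bar>c j\<bar> \<le> int q" and p: "\<And>j. j \<in> J \<Longrightarrow> p j \<le> N"
    and N: "N \<ge> 1" and q: "q \<ge> 1" and M: "M \<ge> 16 * q * N ^ 15"
    and rel: "(\<Sum>j\<in>J. c j * int (sidon M (p j))) = 0"
  shows "(\<Sum>j | j \<in> J \<and> p j = r. c j) = 0"
proof -
  define a where "a t = (\<Sum>j\<in>J. c j * int (p j) ^ t)" for t
  have small: "\<bar>a t\<bar> < int M" if t: "t < 15" for t
  proof -
    have "\<bar>a t\<bar> \<le> (\<Sum>j\<in>J. \<bar>c j * int (p j) ^ t\<bar>)" unfolding a_def by (rule sum_abs)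
    also have "\<dots> \<le> (\<Sum>j\<in>J. int q * int N ^ 15)"
    proof (rule sum_mono)
      fix j assume j: "j \<in> J"
      have "int (p j) ^ t \<le> int N ^ t" using p[OF j] by (intro power_mono) auto
      also have "\<dots> \<le> int N ^ 15" using N t by (intro power_increasing) auto
      finally show "\<bar>c j * int (p j) ^ t\<bar> \<le> int q * int N ^ 15"
        using c[OF j] by (simp add: abs_mult mult_mono)
    qed
    also have "\<dots> = int (card J * (q * N ^ 15))" by simp
    also have "\<dots> \<le> int (15 * (q * N ^ 15))"
      using card mult_le_mono1 by (simp only: of_nat_le_iff)
    also have "\<dots> < int (16 * q * N ^ 15)" using N q by simp
    also have "\<dots> \<le> int M" using M by (simp only: of_nat_le_iff)
    finally show ?thesis .
  qed
  have "(\<Sum>t<15. a t * int M ^ t) = (\<Sum>j\<in>J. c j * int (sidon M (p j)))"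
    by (simp add: a_def sidon_def sum_distrib_left sum_distrib_right power_mult_distrib
        sum.swap[of _ J] mult_ac del: sum.lessThan_Suc)
  with rel have "(\<Sum>t<15. a t * int M ^ t) = 0" by simp
  then have "a t = 0" if "t < 15" for t
    using small_digits_eq_0[of a "int M" 15 t] small that by blast
  then have "(\<Sum>j | j \<in> J \<and> int (p j) = int r. c j) = 0"
    using fin card by (intro moments_eq_0[where T = 15]) (auto simp: a_def)
  then show ?thesis by simp
qed

lemma sidon_le:
  assumes "p \<le> N" "N \<ge> 1" "M \<ge> 1"
  shows "sidon M p \<le> 15 * (M * N) ^ 15"
proof -
  have "sidon M p \<le> (\<Sum>t<(15::nat). (M * N) ^ 15)"
    unfolding sidon_def
  proof (rule sum_mono)
    fix t :: nat assume "t \<in> {..<15}"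
    have "(M * p) ^ t \<le> (M * N) ^ t" using assms by (intro power_mono) auto
    also have "\<dots> \<le> (M * N) ^ 15" using assms \<open>t \<in> _\<close> by (intro power_increasing) auto
    finally show "(M * p) ^ t \<le> (M * N) ^ 15" .
  qed
  then show ?thesis by simp
qed

section \<open>The gap graph\<close>

definition digit :: "nat \<Rightarrow> nat \<Rightarrow> nat \<Rightarrow> nat" where
  "digit q a i = a div q ^ i mod q"

lemma digit_Suc: "digit q a (Suc i) = digit q (a div q) i"
  by (simp add: digit_def div_mult2_eq)

lemma digit_less [simp]: "q > 0 \<Longrightarrow> digit q a i < q"
  by (simp add: digit_def)

lemma digits_inject:
  "a < q ^ k \<Longrightarrow> b < q ^ k \<Longrightarrow> \<forall>i<k. digit q a i = digit q b i \<Longrightarrow> a = b"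
proof (induction k arbitrary: a b)
  case (Suc k)
  have "a div q = b div q"
  proof (rule Suc.IH)
    show "a div q < q ^ k" "b div q < q ^ k"
      using Suc.prems by (simp_all add: less_mult_imp_div_less mult.commute)
    show "\<forall>i<k. digit q (a div q) i = digit q (b div q) i"
      using Suc.prems(3) by (auto simp flip: digit_Suc)
  qed
  moreover have "a mod q = b mod q" using Suc.prems(3) by (auto simp: digit_def)
  ultimately show ?case by (metis div_mult_mod_eq)
qed simp

lemma digits_surject:
  "\<forall>i<k. g i < q \<Longrightarrow> \<exists>a<q ^ k. \<forall>i<k. digit q a i = g i"
proof (induction k arbitrary: g)
  case (Suc k)
  then have "\<forall>i<k. g (Suc i) < q" by simp
  from Suc.IH[OF this] obtain a where a: "a < q ^ k" "\<forall>i<k. digit q a i = g (Suc i)" by blast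
  have g: "g 0 < q" using Suc.prems by simp
  have "digit q (a * q + g 0) i = g i" if "i < Suc k" for i
  proof (cases i)
    case 0
    then show ?thesis using g by (simp add: digit_def)
  next
    case (Suc j)
    then show ?thesis using g a that by (simp add: digit_Suc)
  qed
  moreover have "a * q + g 0 < q ^ Suc k"
  proof -
    have "a * q + g 0 < Suc a * q" using g by simp
    also have "\<dots> \<le> q ^ k * q" using a(1) by (intro mult_le_mono1) simp
    finally show ?thesis by (simp add: mult.commute)
  qed
  ultimately show ?case by blast
qed simp

section \<open>Parameters and adjacency of the constructed graph\<close>

definition diff_list :: "nat \<Rightarrow> nat \<Rightarrow> nat \<Rightarrow> nat \<Rightarrow> nat list" where
  "diff_list k q a b = filter (\<lambda>i. digit q a i \<noteq> digit q b i) [0..<k]"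

lemma distinct_diff_list [simp]: "distinct (diff_list k q a b)"
  by (simp add: diff_list_def)

lemma diff_list_commute: "diff_list k q a b = diff_list k q b a"
  unfolding diff_list_def by (rule filter_cong) auto

lemma diff_list_eq_Nil: "a < q ^ k \<Longrightarrow> b < q ^ k \<Longrightarrow> diff_list k q a b = [] \<longleftrightarrow> a = b"
  using digits_inject[of a q k b] by (auto simp: diff_list_def filter_empty_conv)

text \<open>Majorises every code \<open>i * n + v\<close> of a coordinate \<open>i < k\<close> and a
  vertex \<open>v < n\<close>; the \<open>+ 1\<close> keeps it positive for the empty graph.\<close>

definition bound :: "nat \<Rightarrow> nat \<Rightarrow> nat" where
  "bound n k = k * n + 1"

definition base :: "nat \<Rightarrow> nat \<Rightarrow> nat \<Rightarrow> nat" where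
  "base n k q = 16 * q * bound n k ^ 15"

text \<open>Exceeds each sum of \<open>k\<close> products of a digit and a \<open>sidon\<close>
  number, so that the values of the intended clique fit.\<close>

definition range_size :: "nat \<Rightarrow> nat \<Rightarrow> nat \<Rightarrow> nat" where
  "range_size n k q = k * q * (15 * (base n k q * bound n k) ^ 15) + 1"

definition num_verts :: "nat \<Rightarrow> nat \<Rightarrow> nat \<Rightarrow> nat" where
  "num_verts n k q = q ^ k * range_size n k q"

text \<open>
  In \<open>shift\<close> and \<open>witness\<close>, the base \<open>n\<close> digits of \<open>z\<close> encode the vertices of \<open>G\<close> guessed for the at
  most five coordinates in \<open>L\<close>. A vertex \<open>a\<close> of the constructed graph encodes the point with base \<open>q\<close>
  digits \<open>a mod q ^ k\<close> and the value \<open>a div q ^ k\<close>.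
\<close>

definition shift :: "nat \<Rightarrow> nat \<Rightarrow> nat \<Rightarrow> nat list \<Rightarrow> nat \<Rightarrow> nat \<Rightarrow> nat" where
  "shift n M q L a z = (\<Sum>r<5. if r < length L
     then digit q a (L ! r) * sidon M (L ! r * n + digit n z r) else 0)"

definition witness :: "graph \<Rightarrow> nat \<Rightarrow> nat \<Rightarrow> nat \<Rightarrow> nat \<Rightarrow> nat \<Rightarrow> bool" where
  "witness G k q a b z \<longleftrightarrow> (let n = fst G; M = base n k q; Q = q ^ k; L = diff_list k q (a mod Q) (b mod Q) in
     a div Q + shift n M q L (b mod Q) z = b div Q + shift n M q L (a mod Q) z \<and>
     (2 \<le> length L \<longrightarrow> {digit n z 0, digit n z 1} \<in> edges G))"

text \<open>Requiring \<open>L \<noteq> []\<close> forces distinct members of a clique to have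
  distinct points. The range of \<open>z\<close> covers all guesses of five vertices and still has
  polynomial size.\<close>

definition adjacent :: "graph \<Rightarrow> nat \<Rightarrow> nat \<Rightarrow> nat \<Rightarrow> nat \<Rightarrow> bool" where
  "adjacent G k q a b \<longleftrightarrow> (let L = diff_list k q (a mod q ^ k) (b mod q ^ k) in
     L \<noteq> [] \<and> (length L \<le> 5 \<longrightarrow> (\<exists>z < fst G ^ 5. witness G k q a b z)))"

definition gap_graph :: "graph \<Rightarrow> nat \<Rightarrow> nat \<Rightarrow> graph" where
  "gap_graph G k q = (let m = num_verts (fst G) k q in
     (m, {{a, b} | a b. a < m \<and> b < m \<and> adjacent G k q a b}))"

lemma adjacent_commute: "adjacent G k q a b = adjacent G k q b a"
proof -
  have "witness G k q a b z = witness G k q b a z" for z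
    unfolding witness_def Let_def by (auto simp: diff_list_commute)
  then show ?thesis unfolding adjacent_def Let_def by (simp add: diff_list_commute)
qed

lemma adjacent_irrefl [simp]: "\<not> adjacent G k q a a"
  by (simp add: adjacent_def diff_list_def)

lemma fst_gap_graph [simp]: "fst (gap_graph G k q) = num_verts (fst G) k q"
  by (simp add: gap_graph_def Let_def)

lemma edges_gap_graph_iff:
  assumes "a < num_verts (fst G) k q" "b < num_verts (fst G) k q"
  shows "{a, b} \<in> edges (gap_graph G k q) \<longleftrightarrow> adjacent G k q a b"
  using assms adjacent_commute[of G k q a b]
  by (auto simp: edges_def gap_graph_def Let_def doubleton_eq_iff)

lemma is_graph_gap_graph: "is_graph (gap_graph G k q)"
proof -
  have "{a, b} \<in> nsets (verts (gap_graph G k q)) 2"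
    if "a < num_verts (fst G) k q" "b < num_verts (fst G) k q" "adjacent G k q a b" for a b
    using that by (auto simp: nsets_def verts_def card_insert_if)
  then show ?thesis
    by (auto simp: is_graph_def edges_def gap_graph_def[of G k q] Let_def)
qed

text \<open>The program evaluates expressions of fixed shape, hence the padded sum of constant
  length; the proofs work with the sum over coordinates.\<close>

lemma sum_nth_padded:
  assumes "distinct L" "length L \<le> R"
  shows "(\<Sum>r<R. if r < length L then f (L ! r) else 0) = (\<Sum>i\<in>set L. f i)"
    (is "sum ?g _ = _")
proof -
  have "sum ?g {..<R} = sum ?g {..<length L}"
    using assms(2) by (intro sum.mono_neutral_right) auto
  also have "\<dots> = (\<Sum>r<length L. f (L ! r))" by simp
  also have "\<dots> = (\<Sum>i\<in>set L. f i)"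
    using bij_betw_nth[OF assms(1), of "{..<length L}" "set L"] by (intro sum.reindex_bij_betw) auto
  finally show ?thesis .
qed

lemma shift_eq:
  assumes "distinct L" "length L \<le> 5" "\<And>r. r < length L \<Longrightarrow> g (L ! r) = digit n z r"
  shows "shift n M q L a z = (\<Sum>i\<in>set L. digit q a i * sidon M (i * n + g i))"
proof -
  have "shift n M q L a z =
      (\<Sum>r<5. if r < length L then digit q a (L ! r) * sidon M (L ! r * n + g (L ! r)) else 0)"
    unfolding shift_def using assms(3) by (intro sum.cong) auto
  also have "\<dots> = (\<Sum>i\<in>set L. digit q a i * sidon M (i * n + g i))"
    by (rule sum_nth_padded[OF assms(1,2)])
  finally show ?thesis .
qed

section \<open>Completeness: a \<open>k\<close>-clique of \<open>G\<close> yields a clique of size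
  \<open>q ^ k\<close>\<close>

lemma index_le:
  assumes "i < k" "v < n"
  shows "i * n + v \<le> bound n k"
proof -
  have "i * n + v < Suc i * n" using assms by simp
  also have "\<dots> \<le> k * n" using assms by (intro mult_le_mono1) simp
  finally show ?thesis by (simp add: bound_def)
qed

lemma base_pos: "q \<ge> 1 \<Longrightarrow> base n k q \<ge> 1"
  by (simp add: base_def bound_def Suc_le_eq)

lemma index_inject:
  assumes "i * n + v = j * n + w" "v < n" "w < (n::nat)"
  shows "i = j" "v = w"
proof -
  have "(i * n + v) div n = i" "(j * n + w) div n = j" using assms(2,3) by simp_all
  then show "i = j" using assms(1) by metis
  with assms show "v = w" by simp
qed

text \<open>Coordinates in which two points agree contribute equally to \<open>S a\<close> and
  \<open>S b\<close>. The difference is thus explained by the clique vertices at the differing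
  coordinates, and these are pairwise adjacent.\<close>

lemma gap_graph_complete:
  assumes k: "k \<ge> 1" and q: "q \<ge> 1" and cl: "has_clique G k"
  shows "has_clique (gap_graph G k q) (q ^ k)"
proof -
  define n Q M where "n = fst G" and "Q = q ^ k" and "M = base n k q"
  have Q: "Q > 0" using q by (simp add: Q_def)
  obtain C where C: "C \<subseteq> {..<n}" "card C = k" "clique C (edges G)"
    using cl by (auto simp: has_clique_def verts_def n_def)
  then have "finite C" using finite_subset by blast
  then obtain v where v: "bij_betw v {..<k} C"
    using C(2) ex_bij_betw_nat_finite[of C] by (auto simp: atLeast0LessThan)
  have vC: "v i \<in> C" if "i < k" for i using v that by (auto simp: bij_betw_def)
  then have vn: "v i < n" if "i < k" for i using C(1) that by blast
  have vE: "{v i, v j} \<in> edges G" if "i < k" "j < k" "i \<noteq> j" for i j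
  proof -
    have "v i \<noteq> v j" using v that by (auto simp: bij_betw_def inj_on_def)
    then show ?thesis using C(3) vC that by (auto simp: clique_def)
  qed
  define S where "S a = (\<Sum>i<k. digit q a i * sidon M (i * n + v i))" for a
  define h where "h a = a + Q * S a" for a
  have h: "h a mod Q = a" "h a div Q = S a" if "a < Q" for a
    using that Q by (simp_all add: h_def)
  have S: "S a < range_size n k q" for a
  proof -
    have "S a \<le> (\<Sum>i<k. q * (15 * (M * bound n k) ^ 15))"
      unfolding S_def
    proof (intro sum_mono mult_le_mono)
      fix i assume "i \<in> {..<k}"
      then have "i * n + v i \<le> bound n k" using vn index_le by simp
      then show "sidon M (i * n + v i) \<le> 15 * (M * bound n k) ^ 15"
        using base_pos[OF q] by (intro sidon_le) (simp_all add: M_def bound_def)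
      show "digit q a i \<le> q" using q by (intro less_imp_le digit_less) simp
    qed
    then show ?thesis by (simp add: range_size_def M_def mult.assoc)
  qed
  have less: "h a < num_verts n k q" if "a < Q" for a
  proof -
    have "h a < Q * Suc (S a)" using that by (simp add: h_def)
    also have "\<dots> \<le> Q * range_size n k q" using S[of a] by (intro mult_le_mono2) simp
    finally show ?thesis by (simp add: num_verts_def Q_def)
  qed
  have adj: "adjacent G k q (h a) (h b)" if ab: "a < Q" "b < Q" "a \<noteq> b" for a b
  proof -
    define L where "L = diff_list k q a b"
    have ne: "L \<noteq> []" using ab diff_list_eq_Nil by (simp add: L_def Q_def)
    have dL: "distinct L" by (simp add: L_def)
    have Lk: "set L \<subseteq> {..<k}" by (auto simp: L_def diff_list_def)
    then have Lr: "L ! r < k" if "r < length L" for r using that nth_mem by blast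
    have "\<exists>z < n ^ 5. witness G k q (h a) (h b) z" if len: "length L \<le> 5"
    proof -
      have "\<forall>r<5. (if r < length L then v (L ! r) else v 0) < n" using vn Lr k by auto
      from digits_surject[OF this] obtain z where z: "z < n ^ 5"
        "\<forall>r<5. digit n z r = (if r < length L then v (L ! r) else v 0)" by blast
      have sh: "shift n M q L c z = (\<Sum>i\<in>set L. digit q c i * sidon M (i * n + v i))" for c
        using z len by (intro shift_eq dL) auto
      have split: "S c = (\<Sum>i\<in>{..<k} - set L. digit q c i * sidon M (i * n + v i)) +
          (\<Sum>i\<in>set L. digit q c i * sidon M (i * n + v i))" for c
        unfolding S_def by (rule sum.subset_diff[OF Lk]) simp
      have "(\<Sum>i\<in>{..<k} - set L. digit q a i * sidon M (i * n + v i)) =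
          (\<Sum>i\<in>{..<k} - set L. digit q b i * sidon M (i * n + v i))"
        by (intro sum.cong) (auto simp: L_def diff_list_def)
      then have "S a + shift n M q L b z = S b + shift n M q L a z"
        by (simp add: sh split[of a] split[of b])
      moreover have "{digit n z 0, digit n z 1} \<in> edges G" if "2 \<le> length L"
      proof -
        have "0 < length L" "1 < length L" using that by auto
        then have "digit n z 0 = v (L ! 0)" "digit n z 1 = v (L ! 1)" "L ! 0 \<noteq> L ! 1"
          using z(2) len dL nth_eq_iff_index_eq[of L 0 1] by auto
        then show ?thesis using vE[OF Lr Lr, of 0 1] that ne by simp
      qed
      ultimately have "witness G k q (h a) (h b) z"
        using h ab unfolding witness_def Let_def Q_def[symmetric] n_def[symmetric] M_def[symmetric]
        by (simp add: L_def[symmetric])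
      with z show ?thesis by blast
    qed
    then show ?thesis
      using ne h ab unfolding adjacent_def Let_def Q_def[symmetric] n_def[symmetric]
      by (simp add: L_def[symmetric])
  qed
  have "inj_on h {..<Q}" by (rule inj_on_inverseI[of _ "\<lambda>b. b mod Q"]) (simp add: h)
  then have "card (h ` {..<Q}) = q ^ k" by (simp add: card_image Q_def)
  moreover have "clique (h ` {..<Q}) (edges (gap_graph G k q))"
    using adj less by (auto simp: clique_def n_def edges_gap_graph_iff)
  moreover have "h ` {..<Q} \<subseteq> verts (gap_graph G k q)"
    using less by (auto simp: verts_def n_def)
  ultimately show ?thesis unfolding has_clique_def by blast
qed

section \<open>Soundness: explanations of close pairs are unique and consistent\<close>

text \<open>
  \<open>g\<close> explains the values \<open>u\<close> and \<open>w\<close> at the points \<open>x\<close> and \<open>y\<close>: the equation is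
  \<open>u - w = (\<Sum>i. (x\<^sub>i - y\<^sub>i) s(i, g\<^sub>i))\<close>, arranged to avoid truncated subtraction.
\<close>

definition labels :: "graph \<Rightarrow> nat \<Rightarrow> nat \<Rightarrow> (nat \<Rightarrow> nat) \<Rightarrow> nat \<Rightarrow> (nat \<Rightarrow> nat) \<Rightarrow> nat \<Rightarrow> (nat \<Rightarrow> nat) \<Rightarrow> bool"
  where
  "labels G k M x u y w g \<longleftrightarrow> (\<forall>i\<in>dset k x y. g i < fst G) \<and>
     u + (\<Sum>i\<in>dset k x y. y i * sidon M (i * fst G + g i)) =
     w + (\<Sum>i\<in>dset k x y. x i * sidon M (i * fst G + g i)) \<and>
     (\<forall>i j. dset k x y = {i, j} \<longrightarrow> i \<noteq> j \<longrightarrow> {g i, g j} \<in> edges G)"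

lemma labels_commute: "labels G k M x u y w g \<longleftrightarrow> labels G k M y w x u g"
  unfolding labels_def dset_commute[of k y x] by auto

text \<open>Serves as a degenerate side of a triangle: with it, \<open>labels_unique\<close>
  compares two explanations of the same pair.\<close>

lemma labels_refl: "labels G k M x u x u g"
  by (simp add: labels_def dset_def)

text \<open>Adding the equations around the triangle cancels \<open>u\<close>, \<open>v\<close> and
  \<open>w\<close> and leaves a relation between at most 15 \<open>sidon\<close> numbers. If
  \<open>g1 i\<close> and \<open>g3 i\<close> differed, the total coefficient at the code of
  \<open>i\<close> and \<open>g1 i\<close> would be \<open>x i - y i\<close> or
  \<open>x i - z i\<close>, both nonzero.\<close>

lemma labels_unique:
  assumes l1: "labels G k M x u y v g1" and l2: "labels G k M y v z w g2"
    and l3: "labels G k M x u z w g3"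
    and card: "card (dset k x y) \<le> 5" "card (dset k y z) \<le> 5" "card (dset k x z) \<le> 5"
    and i: "i \<in> dset k x y" "i \<in> dset k x z" and q: "q \<ge> 1" and M: "M = base (fst G) k q"
    and less: "\<And>i. i < k \<Longrightarrow> x i < q \<and> y i < q \<and> z i < q"
  shows "g1 i = g3 i"
proof (rule ccontr)
  assume neq: "g1 i \<noteq> g3 i"
  let ?n = "fst G"
  \<comment> \<open>The number \<open>t\<close> names a side of the triangle; the third side is
    traversed from \<open>z\<close> back to \<open>x\<close>, which fixes its sign in
    \<open>c\<close>.\<close>
  define D :: "nat \<Rightarrow> nat set" where "D t = (if t = 0 then dset k x y else if t = 1 then dset k y z else dset k x z)" for t
  define g where "g t = (if t = 0 then g1 else if t = 1 then g2 else g3)" for t :: nat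
  define c where "c j = (case j of (t, i) \<Rightarrow>
    if t = 0 then int (x i) - int (y i) else if t = 1 then int (y i) - int (z i) else int (z i) - int (x i))"
    for j :: "nat \<times> nat"
  define p where "p j = (case j of (t, i) \<Rightarrow> i * ?n + g t i)" for j :: "nat \<times> nat"
  define J where "J = Sigma {..<3} D"
  have fin: "finite J" by (auto simp: J_def D_def)
  have three: "{..<3} = {0, 1, 2 :: nat}" by auto
  have cardJ: "card J \<le> 15"
    using card by (simp add: J_def three D_def)
  have gn: "g t i < ?n" if "i \<in> D t" for t i
    using that l1 l2 l3 by (auto simp: labels_def D_def g_def split: if_splits)
  have Dk: "i < k" if "i \<in> D t" for t i
    using that by (auto simp: D_def dset_iff split: if_splits)
  have "int u + (\<Sum>i\<in>dset k x y. int (y i) * int (sidon M (i * ?n + g1 i))) =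
      int v + (\<Sum>i\<in>dset k x y. int (x i) * int (sidon M (i * ?n + g1 i)))"
    using arg_cong[OF conjunct1[OF conjunct2[OF l1[unfolded labels_def]]], of int] by simp
  then have 1: "(\<Sum>i\<in>dset k x y. (int (x i) - int (y i)) * int (sidon M (i * ?n + g1 i))) = int u - int v"
    by (simp add: left_diff_distrib sum_subtractf)
  have "int v + (\<Sum>i\<in>dset k y z. int (z i) * int (sidon M (i * ?n + g2 i))) =
      int w + (\<Sum>i\<in>dset k y z. int (y i) * int (sidon M (i * ?n + g2 i)))"
    using arg_cong[OF conjunct1[OF conjunct2[OF l2[unfolded labels_def]]], of int] by simp
  then have 2: "(\<Sum>i\<in>dset k y z. (int (y i) - int (z i)) * int (sidon M (i * ?n + g2 i))) = int v - int w"
    by (simp add: left_diff_distrib sum_subtractf)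
  have "int u + (\<Sum>i\<in>dset k x z. int (z i) * int (sidon M (i * ?n + g3 i))) =
      int w + (\<Sum>i\<in>dset k x z. int (x i) * int (sidon M (i * ?n + g3 i)))"
    using arg_cong[OF conjunct1[OF conjunct2[OF l3[unfolded labels_def]]], of int] by simp
  then have 3: "(\<Sum>i\<in>dset k x z. (int (z i) - int (x i)) * int (sidon M (i * ?n + g3 i))) = int w - int u"
    by (simp add: left_diff_distrib sum_subtractf)
  have "(\<Sum>j\<in>J. c j * int (sidon M (p j))) = (\<Sum>t<3. \<Sum>i\<in>D t. c (t, i) * int (sidon M (p (t, i))))"
    unfolding J_def by (subst sum.Sigma) (auto simp: D_def)
  also have "\<dots> = 0"
    using 1 2 3 unfolding three by (simp add: c_def p_def D_def g_def)
  finally have rel: "(\<Sum>j\<in>J. c j * int (sidon M (p j))) = 0" .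
  have c_le: "\<bar>c j\<bar> \<le> int q" if "j \<in> J" for j
  proof -
    obtain t i where j: "j = (t, i)" by (cases j)
    then have "i < k" using that Dk[of i t] by (simp add: J_def)
    with j show ?thesis using less[of i] by (auto simp: c_def)
  qed
  have p_le: "p j \<le> bound ?n k" if "j \<in> J" for j
    using that gn Dk index_le by (auto simp: J_def p_def)
  have 0: "(\<Sum>j | j \<in> J \<and> p j = i * ?n + g1 i. c j) = 0"
    by (rule sidon_independent[OF fin cardJ c_le p_le _ q _ rel]) (simp_all add: M base_def bound_def)
  \<comment> \<open>Codes determine coordinate and vertex, so only the coordinate \<open>i\<close>
    occurs, at most once per side; the side between \<open>x\<close> and \<open>z\<close> drops out
    by \<open>neq\<close>.\<close>
  have set: "{j \<in> J. p j = i * ?n + g1 i} =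
      insert (0, i) (if i \<in> dset k y z \<and> g2 i = g1 i then {(1, i)} else {})" (is "?A = ?B")
  proof (rule set_eqI)
    fix j :: "nat \<times> nat"
    obtain t h where j: "j = (t, h)" by (cases j)
    have g1n: "g1 i < ?n" using i l1 by (simp add: labels_def)
    have "j \<in> ?A \<longleftrightarrow> t < 3 \<and> i \<in> D t \<and> h = i \<and> g t i = g1 i"
      using index_inject[OF _ gn g1n, of h t h i] by (auto simp: J_def p_def j)
    also have "\<dots> \<longleftrightarrow> h = i \<and> (t = 0 \<or> t = 1 \<and> i \<in> dset k y z \<and> g2 i = g1 i)"
      using i neq by (auto simp: D_def g_def)
    also have "\<dots> \<longleftrightarrow> j \<in> ?B" by (auto simp: j)
    finally show "j \<in> ?A \<longleftrightarrow> j \<in> ?B" .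
  qed
  have xi: "x i \<noteq> y i" "x i \<noteq> z i" using i by (auto simp: dset_iff)
  show False
  proof (cases "i \<in> dset k y z \<and> g2 i = g1 i")
    case True
    then have "c (0, i) + c (1, i) = 0" using 0 by (simp only: set if_True) simp
    then show False using xi by (simp add: c_def)
  next
    case False
    then have "c (0, i) = 0" using 0 by (simp only: set if_False) simp
    then show False using xi by (simp add: c_def)
  qed
qed

text \<open>Members of a clique have distinct points, so each point \<open>x\<close> has one value
  \<open>f x\<close>. Adjacency yields the labels for \<open>consistent_labels_give_clique\<close>,
  and \<open>labels_unique\<close> makes them symmetric and consistent.\<close>

lemma gap_graph_sound:
  assumes G: "is_graph G" and k: "k \<ge> 1" and q: "q \<ge> 1"
    and cl: "has_clique (gap_graph G k q) (q ^ (k - 1) + 1)"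
  shows "has_clique G k"
proof -
  define n Q M where "n = fst G" and "Q = q ^ k" and "M = base n k q"
  have Q: "Q > 0" using q by (simp add: Q_def)
  obtain K where K: "K \<subseteq> {..<num_verts n k q}" "card K = q ^ (k - 1) + 1"
      "clique K (edges (gap_graph G k q))"
    using cl by (auto simp: has_clique_def verts_def n_def)
  have adj: "adjacent G k q a b" if "a \<in> K" "b \<in> K" "a \<noteq> b" for a b
    using K that edges_gap_graph_iff[of a G k q b] by (auto simp: clique_def n_def)
  \<comment> \<open>The restriction places the points in \<open>PiE\<close>, where functions are
    determined by their first \<open>k\<close> values.\<close>
  define X where "X a = restrict (digit q (a mod Q)) {..<k}" for a
  have dset_X: "dset k (X a) (X b) = set (diff_list k q (a mod Q) (b mod Q))" for a b
    by (auto simp: dset_def X_def diff_list_def)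
  have inj: "inj_on X K"
  proof (rule inj_onI, rule ccontr)
    fix a b assume ab: "a \<in> K" "b \<in> K" "X a = X b" "a \<noteq> b"
    have "adjacent G k q a b" using adj ab by simp
    then have "diff_list k q (a mod Q) (b mod Q) \<noteq> []" by (simp add: adjacent_def Let_def Q_def)
    then have "dset k (X a) (X b) \<noteq> {}" by (simp add: dset_X)
    then show False using ab by (simp add: dset_def)
  qed
  define h where "h = inv_into K X"
  have h: "h x \<in> K" "X (h x) = x" if "x \<in> X ` K" for x
    using that by (auto simp: h_def inv_into_into f_inv_into_f)
  define f where "f x = h x div Q" for x
  have less: "x i < q" if "x \<in> X ` K" "i < k" for x i
    using that q by (auto simp: X_def)
  have ex: "\<exists>g. labels G k M x (f x) y (f y) g"
    if x: "x \<in> X ` K" and y: "y \<in> X ` K" and card: "card (dset k x y) \<le> 5" for x y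
  proof (cases "x = y")
    case True
    then show ?thesis using labels_refl by blast
  next
    case False
    define L where "L = diff_list k q (h x mod Q) (h y mod Q)"
    have dL: "distinct L" by (simp add: L_def)
    have D: "dset k x y = set L" using dset_X[of "h x" "h y"] h x y by (simp add: L_def)
    then have len: "length L \<le> 5" using card dL by (simp add: distinct_card)
    have "h x \<noteq> h y" using False h x y by metis
    then have "adjacent G k q (h x) (h y)" using adj h x y by simp
    then obtain z where z: "z < n ^ 5" "witness G k q (h x) (h y) z"
      using len by (auto simp: adjacent_def Let_def L_def Q_def n_def)
    have n: "n > 0" using z(1) by (cases n) auto
    \<comment> \<open>Transfers the guessed vertices from list positions to coordinates.\<close>
    define g where "g = (\<lambda>i. digit n z (inv_into {..<length L} (nth L) i))"
    have g: "g (L ! r) = digit n z r" if "r < length L" for r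
      using that inj_on_nth[OF dL, of "{..<length L}"] by (simp add: g_def inv_into_f_f)
    have sh: "shift n M q L a z = (\<Sum>i\<in>set L. digit q a i * sidon M (i * n + g i))" for a
      by (rule shift_eq[OF dL len g])
    have dig: "digit q (h x mod Q) i = x i" "digit q (h y mod Q) i = y i" if "i < k" for i
      using h(2)[OF x] h(2)[OF y] that by (auto simp: X_def fun_eq_iff split: if_splits)
    have Lk: "i < k" if "i \<in> set L" for i using that D by (auto simp: dset_def)
    have "f x + shift n M q L (h y mod Q) z = f y + shift n M q L (h x mod Q) z"
      using z(2) by (simp add: witness_def Let_def f_def L_def Q_def n_def M_def)
    then have eq: "f x + (\<Sum>i\<in>set L. y i * sidon M (i * n + g i)) =
        f y + (\<Sum>i\<in>set L. x i * sidon M (i * n + g i))"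
      using dig Lk by (simp add: sh)
    have "{g i, g j} \<in> edges G" if ij: "set L = {i, j}" "i \<noteq> j" for i j
    proof -
      have len2: "length L = 2" using ij distinct_card[OF dL] by simp
      then obtain a b where L: "L = [a, b]" by (auto simp: numeral_2_eq_2 length_Suc_conv)
      have "{g i, g j} = g ` set L" by (simp add: ij)
      also have "\<dots> = {g (L ! 0), g (L ! 1)}" by (simp add: L)
      also have "\<dots> = {digit n z 0, digit n z 1}" using g len2 by simp
      finally show ?thesis
        using z(2) len2 by (simp add: witness_def Let_def L_def Q_def n_def)
    qed
    then have "labels G k M x (f x) y (f y) g"
      using eq n by (auto simp: labels_def D g_def n_def)
    then show ?thesis by blast
  qed
  define w where "w x y = (SOME g. labels G k M x (f x) y (f y) g)" for x y
  have w: "labels G k M x (f x) y (f y) (w x y)"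
    if "x \<in> X ` K" "y \<in> X ` K" "card (dset k x y) \<le> 5" for x y
    unfolding w_def using ex[OF that] by (rule someI_ex)
  have "\<exists>v \<in> {..<k} \<rightarrow> {..<n}. \<forall>i<k. \<forall>j<k. i \<noteq> j \<longrightarrow> {v i, v j} \<in> edges G"
  proof (rule consistent_labels_give_clique[OF _ k q])
    show "X ` K \<subseteq> PiE {..<k} (\<lambda>_. {..<q})"
      using q by (auto simp: X_def split: if_splits)
    show "w x y i \<in> {..<n}"
      if "x \<in> X ` K" "y \<in> X ` K" "card (dset k x y) \<le> 5" "i \<in> dset k x y" for x y i
      using w[OF that(1-3)] that(4) by (simp add: labels_def n_def)
    show "w x y i = w y x i"
      if xy: "x \<in> X ` K" "y \<in> X ` K" "card (dset k x y) \<le> 5" "i \<in> dset k x y" for x y i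
    proof -
      have "labels G k M x (f x) y (f y) (w y x)"
        using w[of y x] xy by (simp add: labels_commute dset_commute)
      from labels_unique[OF w[OF xy(1-3)] labels_refl this] show ?thesis
        using xy less q by (simp add: M_def n_def dset_def)
    qed
    show "w x y i = w x z i"
      if xyz: "x \<in> X ` K" "y \<in> X ` K" "z \<in> X ` K" "card (dset k x y) \<le> 5" "card (dset k x z) \<le> 5"
        "card (dset k y z) \<le> 5" "i \<in> dset k x y" "i \<in> dset k x z" for x y z i
      by (rule labels_unique[OF w[OF xyz(1,2,4)] w[OF xyz(2,3,6)] w[OF xyz(1,3,5)]])
        (use xyz less q in \<open>auto simp: M_def n_def\<close>)
    show "{w x y i, w x y j} \<in> edges G"
      if xy: "x \<in> X ` K" "y \<in> X ` K" "dset k x y = {i, j}" "i \<noteq> j" for x y i j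
      using w[OF xy(1,2)] xy(3,4) by (simp add: labels_def)
    show "q ^ (k - 1) < card (X ` K)" using K inj by (simp add: card_image)
  qed
  then obtain v where v: "v \<in> {..<k} \<rightarrow> {..<n}"
    "\<And>i j. i < k \<Longrightarrow> j < k \<Longrightarrow> i \<noteq> j \<Longrightarrow> {v i, v j} \<in> edges G" by blast
  \<comment> \<open>Edges of \<open>G\<close> have two elements, so adjacency of the labels also
    makes them distinct.\<close>
  have "v i \<noteq> v j" if "i < k" "j < k" "i \<noteq> j" for i j
  proof -
    have "card {v i, v j} = 2"
      using v(2)[OF that] G by (auto simp: is_graph_def nsets_def)
    then show ?thesis by auto
  qed
  then have "card (v ` {..<k}) = k" by (subst card_image) (auto simp: inj_on_def)
  moreover have "clique (v ` {..<k}) (edges G)" unfolding clique_def using v(2) by blast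
  moreover have "v ` {..<k} \<subseteq> verts G" using v(1) by (auto simp: verts_def n_def)
  ultimately show ?thesis unfolding has_clique_def by blast
qed

section \<open>Running times\<close>

text \<open>
  All values stored by the program below are polynomially bounded, so instead of bit lengths the
  cost is measured by polynomials in a common bound \<open>V\<close> on all cells and all loop counts.
\<close>

fun val_poly :: "aexp \<Rightarrow> nat poly" where
  "val_poly (Num n) = [:n:]"
| "val_poly (Get x a) = [:0, 1:]"
| "val_poly (Add a b) = val_poly a + val_poly b"
| "val_poly (Sub a b) = val_poly a"
| "val_poly (Mul a b) = val_poly a * val_poly b"
| "val_poly (Div a b) = val_poly a"

fun cost_poly :: "aexp \<Rightarrow> nat poly" where
  "cost_poly (Num n) = [:n + 2:]"
| "cost_poly (Get x a) = cost_poly a + val_poly (Get x a) + [:2:]"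
| "cost_poly (Add a b) = cost_poly a + cost_poly b + val_poly (Add a b) + [:2:]"
| "cost_poly (Sub a b) = cost_poly a + cost_poly b + val_poly (Sub a b) + [:2:]"
| "cost_poly (Mul a b) = cost_poly a + cost_poly b + val_poly (Mul a b) + [:2:]"
| "cost_poly (Div a b) = cost_poly a + cost_poly b + val_poly (Div a b) + [:2:]"

text \<open>The loop case allows for \<open>V\<close> rounds, \<open>[:0, 1:]\<close> standing for
  \<open>V\<close>; the loop rules below therefore demand a round count of at most
  \<open>V\<close>.\<close>

fun time_poly :: "com \<Rightarrow> nat poly" where
  "time_poly Skip = 1"
| "time_poly (Assign x a e) = cost_poly a + cost_poly e"
| "time_poly (Seq c1 c2) = time_poly c1 + time_poly c2"
| "time_poly (IfNZ b c1 c2) = cost_poly b + time_poly c1 + time_poly c2"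
| "time_poly (WhileNZ b c) = cost_poly b + [:0, 1:] * (cost_poly b + time_poly c)"

definition bounded_by :: "nat \<Rightarrow> state \<Rightarrow> bool" where
  "bounded_by V s \<longleftrightarrow> (\<forall>x i. s x i \<le> V)"

lemma len_le: "len n \<le> n + 2"
proof -
  have "floorlog 2 n \<le> n + 1"
    by (rule floorlog_leI) (auto intro: order.strict_trans2[OF less_exp])
  then show ?thesis by (simp add: len_def)
qed

lemma val_le: "bounded_by V s \<Longrightarrow> val s e \<le> poly (val_poly e) V"
proof (induction e)
  case (Div a b)
  then show ?case using div_le_dividend le_trans by (simp, blast)
qed (auto simp: bounded_by_def intro: add_mono mult_le_mono)

lemma cost_le: "bounded_by V s \<Longrightarrow> cost s e \<le> poly (cost_poly e) V"
proof (induction e)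
  case (Num n)
  then show ?case using len_le[of n] by simp
next
  case (Get x a)
  then show ?case using len_le[of "val s (Get x a)"] val_le[of V s "Get x a"] by simp
next
  case (Add a b)
  then show ?case using len_le[of "val s (Add a b)"] val_le[of V s "Add a b"] by simp
next
  case (Sub a b)
  then show ?case using len_le[of "val s (Sub a b)"] val_le[of V s "Sub a b"] by simp
next
  case (Mul a b)
  then show ?case using len_le[of "val s (Mul a b)"] val_le[of V s "Mul a b"] by simp
next
  case (Div a b)
  then show ?case using len_le[of "val s (Div a b)"] val_le[of V s "Div a b"] by simp
qed

section \<open>Total-correctness rules that carry time and memory bounds\<close>

definition wp :: "nat \<Rightarrow> com \<Rightarrow> (state \<Rightarrow> bool) \<Rightarrow> state \<Rightarrow> bool" where
  "wp V c R s \<longleftrightarrow>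
    (\<exists>t s'. exec c s t s' \<and> t \<le> poly (time_poly c) V \<and> bounded_by V s' \<and> R s')"

abbreviation put :: "string \<Rightarrow> nat \<Rightarrow> nat \<Rightarrow> state \<Rightarrow> state" where
  "put x i v s \<equiv> s(x := (s x)(i := v))"

abbreviation var :: "string \<Rightarrow> aexp" where
  "var x \<equiv> Get x (Num 0)"

abbreviation asg :: "string \<Rightarrow> aexp \<Rightarrow> com"  (infix \<open>::=\<close> 62) where
  "x ::= e \<equiv> Assign x (Num 0) e"

abbreviation seq :: "com \<Rightarrow> com \<Rightarrow> com"  (infixr \<open>;;\<close> 60) where
  "c1 ;; c2 \<equiv> Seq c1 c2"

text \<open>Truncated subtraction makes the guard nonzero exactly while the counter is below the
  value of \<open>e\<close>.\<close>

definition For :: "string \<Rightarrow> aexp \<Rightarrow> com \<Rightarrow> com" where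
  "For x e c = (x ::= Num 0 ;; WhileNZ (Sub e (var x)) (c ;; x ::= Add (var x) (Num 1)))"

lemma bounded_by_put [simp]: "bounded_by V s \<Longrightarrow> v \<le> V \<Longrightarrow> bounded_by V (put x i v s)"
  by (simp add: bounded_by_def)

lemma bounded_byD: "bounded_by V s \<Longrightarrow> s x i \<le> V"
  by (simp add: bounded_by_def)

lemma wpI: "exec c s t s' \<Longrightarrow> t \<le> poly (time_poly c) V \<Longrightarrow> bounded_by V s' \<Longrightarrow> R s' \<Longrightarrow> wp V c R s"
  unfolding wp_def by blast

lemma wpE:
  assumes "wp V c R s"
  obtains t s' where "exec c s t s'" "t \<le> poly (time_poly c) V" "bounded_by V s'" "R s'"
  using assms unfolding wp_def by blast

lemma wp_mono: "wp V c R s \<Longrightarrow> (\<And>s'. bounded_by V s' \<Longrightarrow> R s' \<Longrightarrow> R' s') \<Longrightarrow> wp V c R' s"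
  unfolding wp_def by blast

lemma wp_Skip: "bounded_by V s \<Longrightarrow> R s \<Longrightarrow> wp V Skip R s"
  by (rule wpI[OF exec.Skip]) auto

lemma wp_Assign:
  assumes "bounded_by V s" "val s e \<le> V" "R (put x (val s a) (val s e) s)"
  shows "wp V (Assign x a e) R s"
  using assms by (intro wpI[OF exec.Assign]) (auto intro: add_mono cost_le)

lemma wp_Seq:
  assumes "wp V c1 (wp V c2 R) s"
  shows "wp V (c1 ;; c2) R s"
proof -
  obtain t1 s1 where 1: "exec c1 s t1 s1" "t1 \<le> poly (time_poly c1) V" "wp V c2 R s1"
    using assms by (rule wpE)
  then obtain t2 s2 where "exec c2 s1 t2 s2" "t2 \<le> poly (time_poly c2) V" "bounded_by V s2" "R s2"
    by (elim wpE)
  with 1 show ?thesis by (intro wpI[OF exec.Seq[of c1 s t1 s1 c2 t2 s2]]) auto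
qed

lemma wp_IfNZ:
  assumes b: "bounded_by V s" and "val s b \<noteq> 0 \<Longrightarrow> wp V c1 R s" "val s b = 0 \<Longrightarrow> wp V c2 R s"
  shows "wp V (IfNZ b c1 c2) R s"
proof (cases "val s b = 0")
  case True
  with assms(3) obtain t s' where "exec c2 s t s'" "t \<le> poly (time_poly c2) V" "bounded_by V s'" "R s'"
    by (blast elim: wpE)
  with True cost_le[OF b, of b] show ?thesis
    by (intro wpI[OF exec.IfFalse[of s b c2 t s' c1]]) auto
next
  case False
  with assms(2) obtain t s' where "exec c1 s t s'" "t \<le> poly (time_poly c1) V" "bounded_by V s'" "R s'"
    by (blast elim: wpE)
  with False cost_le[OF b, of b] show ?thesis
    by (intro wpI[OF exec.IfTrue[of s b c1 t s' c2]]) auto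
qed

text \<open>Induction on the number \<open>d\<close> of remaining rounds, each paying for one test
  and one body; estimating \<open>N\<close> by \<open>V\<close> gives the polynomial bound.\<close>

lemma wp_WhileNZ:
  assumes init: "I 0 s" "bounded_by V s" and N: "N \<le> V"
    and guard: "\<And>j s. j < N \<Longrightarrow> I j s \<Longrightarrow> val s b \<noteq> 0"
    and step: "\<And>j s. j < N \<Longrightarrow> I j s \<Longrightarrow> bounded_by V s \<Longrightarrow> wp V c (I (Suc j)) s"
    and exit: "\<And>s. I N s \<Longrightarrow> val s b = 0"
    and post: "\<And>s. I N s \<Longrightarrow> bounded_by V s \<Longrightarrow> R s"
  shows "wp V (WhileNZ b c) R s"
proof -
  let ?B = "poly (cost_poly b) V" and ?C = "poly (time_poly c) V"
  have *: "\<exists>t s'. exec (WhileNZ b c) s t s' \<and> t \<le> ?B + d * (?B + ?C) \<and> bounded_by V s' \<and> I N s'"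
    if "j + d = N" "I j s" "bounded_by V s" for d j s
    using that
  proof (induction d arbitrary: j s)
    case 0
    then show ?case
      using exit cost_le[of V s b] by (auto intro!: exec.WhileFalse exI)
  next
    case (Suc d)
    then have j: "j < N" by simp
    obtain t1 s1 where 1: "exec c s t1 s1" "t1 \<le> ?C" "bounded_by V s1" "I (Suc j) s1"
      using step[OF j Suc.prems(2,3)] by (rule wpE)
    obtain t2 s2 where 2: "exec (WhileNZ b c) s1 t2 s2" "t2 \<le> ?B + d * (?B + ?C)"
        "bounded_by V s2" "I N s2"
      using Suc.IH[of "Suc j" s1] 1 Suc.prems by auto
    have "exec (WhileNZ b c) s (cost s b + t1 + t2) s2"
      using guard[OF j Suc.prems(2)] 1 2 by (intro exec.WhileTrue)
    moreover have "cost s b + t1 + t2 \<le> ?B + Suc d * (?B + ?C)"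
      using 1(2) 2(2) cost_le[OF Suc.prems(3), of b] by simp
    ultimately show ?case using 2(3,4) by blast
  qed
  obtain t s' where s': "exec (WhileNZ b c) s t s'" "t \<le> ?B + N * (?B + ?C)" "bounded_by V s'" "I N s'"
    using *[of 0 N s] init by auto
  have "N * (?B + ?C) \<le> V * (?B + ?C)" using N by (rule mult_le_mono1)
  moreover have "poly (time_poly (WhileNZ b c)) V = ?B + V * (?B + ?C)" by simp
  ultimately have "t \<le> poly (time_poly (WhileNZ b c)) V" using s'(2) by linarith
  then show ?thesis using s' post by (intro wpI[OF s'(1)]) auto
qed

lemma wp_For:
  assumes bnd: "bounded_by V s" and N: "N \<le> V"
    and init: "I 0 (put x 0 0 s)"
    and bound: "\<And>j s. I j s \<Longrightarrow> val s e = N"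
    and step: "\<And>j s. j < N \<Longrightarrow> I j s \<Longrightarrow> bounded_by V s \<Longrightarrow> s x 0 = j \<Longrightarrow>
      wp V c (\<lambda>s'. s' x 0 = j \<and> I (Suc j) (put x 0 (Suc j) s')) s"
    and post: "\<And>s. I N s \<Longrightarrow> bounded_by V s \<Longrightarrow> R s"
  shows "wp V (For x e c) R s"
  unfolding For_def
proof (intro wp_Seq wp_Assign)
  let ?J = "\<lambda>j s. I j s \<and> s x 0 = j"
  let ?s = "put x (val s (Num 0)) (val s (Num 0)) s"
  show "wp V (WhileNZ (Sub e (var x)) (c ;; x ::= Add (var x) (Num 1))) R ?s"
  proof (rule wp_WhileNZ[where I = ?J, OF _ _ N])
    show "?J 0 ?s" using init by simp
    show "bounded_by V ?s" using bnd by (intro bounded_by_put) simp_all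
    fix j s assume j: "j < N" and J: "?J j s" and b: "bounded_by V s"
    show "wp V (c ;; x ::= Add (var x) (Num 1)) (?J (Suc j)) s"
    proof (rule wp_Seq, rule wp_mono[OF step[OF j]])
      fix s' assume "bounded_by V s'" "s' x 0 = j \<and> I (Suc j) (put x 0 (Suc j) s')"
      then show "wp V (x ::= Add (var x) (Num 1)) (?J (Suc j)) s'"
        using j N by (intro wp_Assign) simp_all
    qed (use J b in simp_all)
  qed (use bound post in auto)
qed (use bnd in simp_all)

text \<open>Lengths and exponents are fixed numbers, so sums and powers unfold into expressions
  instead of loops.\<close>

fun sum_exp :: "nat \<Rightarrow> (nat \<Rightarrow> aexp) \<Rightarrow> aexp" where
  "sum_exp 0 f = Num 0"
| "sum_exp (Suc r) f = Add (sum_exp r f) (f r)"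

fun pow_exp :: "aexp \<Rightarrow> nat \<Rightarrow> aexp" where
  "pow_exp e 0 = Num 1"
| "pow_exp e (Suc r) = Mul e (pow_exp e r)"

definition mod_exp :: "aexp \<Rightarrow> aexp \<Rightarrow> aexp" where
  "mod_exp a b = Sub a (Mul (Div a b) b)"

lemma val_sum_exp [simp]: "val s (sum_exp r f) = (\<Sum>t<r. val s (f t))"
  by (induction r) auto

lemma val_pow_exp [simp]: "val s (pow_exp e r) = val s e ^ r"
  by (induction r) auto

lemma val_mod_exp [simp]: "val s (mod_exp a b) = val s a mod val s b"
  by (simp add: mod_exp_def minus_div_mult_eq_mod)

section \<open>The program\<close>

text \<open>With truncated subtraction at least one term is 0, so this is the absolute
  difference.\<close>

definition dist_exp :: "aexp \<Rightarrow> aexp \<Rightarrow> aexp" where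
  "dist_exp a b = Add (Sub a b) (Sub b a)"

definition digit_exp :: "nat \<Rightarrow> aexp" where
  "digit_exp r = mod_exp (Div (var ''z'') (pow_exp (var ''n'') r)) (var ''n'')"

definition sidon_exp :: "aexp \<Rightarrow> aexp" where
  "sidon_exp p = sum_exp 15 (pow_exp (Mul (var ''M'') p))"

definition shift_exp :: "string \<Rightarrow> aexp" where
  "shift_exp x = sum_exp 5 (\<lambda>r. Mul (Get x (Num r))
     (sidon_exp (Add (Mul (Get ''I'' (Num r)) (var ''n'')) (digit_exp r))))"

text \<open>Logic in arithmetic: the product is a conjunction and the outer sum a disjunction. The
  factors test the equation, and that fewer than two coordinates differ or the matrix entry is
  2.\<close>

definition witness_exp :: aexp where
  "witness_exp =
     Mul (Sub (Num 1) (dist_exp (Add (var ''u'') (shift_exp ''D'')) (Add (var ''v'') (shift_exp ''C''))))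
       (Add (Sub (Num 2) (var ''c''))
         (Sub (Get ''G'' (Add (Mul (digit_exp 0) (var ''n'')) (digit_exp 1))) (Num 1)))"

definition bound_exp :: aexp where
  "bound_exp = Add (Mul (var ''k'') (var ''n'')) (Num 1)"

definition base_exp :: aexp where
  "base_exp = Mul (Mul (Num 16) (var ''q'')) (pow_exp bound_exp 15)"

definition size_exp :: aexp where
  "size_exp = Mul (var ''Q'') (Add (Mul (Mul (var ''k'') (var ''q''))
     (Mul (Num 15) (pow_exp (Mul (var ''M'') bound_exp) 15))) (Num 1))"

definition setup_prog :: com where
  "setup_prog =
    (''Q'' ::= Num 1 ;;
     For ''i'' (var ''k'') (''Q'' ::= Mul (var ''Q'') (var ''q'')) ;;
     ''M'' ::= base_exp ;;
     ''m'' ::= size_exp)"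

text \<open>\<open>''e''\<close> is the row-major index of an entry of the output matrix; row and
  column are each split into point and value.\<close>

definition split_prog :: com where
  "split_prog =
    (''x'' ::= mod_exp (Div (var ''e'') (var ''m'')) (var ''Q'') ;;
     ''u'' ::= Div (Div (var ''e'') (var ''m'')) (var ''Q'') ;;
     ''y'' ::= mod_exp (mod_exp (var ''e'') (var ''m'')) (var ''Q'') ;;
     ''v'' ::= Div (mod_exp (var ''e'') (var ''m'')) (var ''Q'') ;;
     ''c'' ::= Num 0 ;;
     For ''r'' (Num 5) (Assign ''C'' (var ''r'') (Num 0) ;; Assign ''D'' (var ''r'') (Num 0)))"

definition scan_prog :: com where
  "scan_prog =
    For ''i'' (var ''k'')
     (IfNZ (dist_exp (mod_exp (var ''x'') (var ''q'')) (mod_exp (var ''y'') (var ''q'')))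
        (Assign ''C'' (var ''c'') (mod_exp (var ''x'') (var ''q'')) ;;
         Assign ''D'' (var ''c'') (mod_exp (var ''y'') (var ''q'')) ;;
         Assign ''I'' (var ''c'') (var ''i'') ;;
         ''c'' ::= Add (var ''c'') (Num 1))
        Skip ;;
      ''x'' ::= Div (var ''x'') (var ''q'') ;;
      ''y'' ::= Div (var ''y'') (var ''q''))"

definition search_prog :: com where
  "search_prog = For ''z'' (pow_exp (var ''n'') 5) (IfNZ witness_exp (''f'' ::= Num 2) Skip)"

definition entry_prog :: com where
  "entry_prog =
    (split_prog ;; scan_prog ;;
     ''f'' ::= Num 1 ;;
     IfNZ (var ''c'') (IfNZ (Sub (var ''c'') (Num 5)) (''f'' ::= Num 2) search_prog) Skip ;;
     Assign ''H'' (var ''e'') (var ''f''))"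

definition reduction :: com where
  "reduction = (setup_prog ;; For ''e'' (Mul (var ''m'') (var ''m'')) entry_prog)"

definition ready :: "graph \<Rightarrow> nat \<Rightarrow> nat \<Rightarrow> state \<Rightarrow> bool" where
  "ready G k q s \<longleftrightarrow> s ''n'' 0 = fst G \<and> s ''k'' 0 = k \<and> s ''q'' 0 = q \<and>
     (\<forall>i < fst G * fst G. s ''G'' i = matrix G i) \<and>
     s ''Q'' 0 = q ^ k \<and> s ''M'' 0 = base (fst G) k q \<and> s ''m'' 0 = num_verts (fst G) k q"

text \<open>Five entries of \<open>''C''\<close> and \<open>''D''\<close> suffice, since a longer
  list of differing coordinates is decided by its length alone.\<close>

definition scanned :: "nat \<Rightarrow> nat \<Rightarrow> nat \<Rightarrow> nat \<Rightarrow> nat list \<Rightarrow> state \<Rightarrow> bool" where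
  "scanned q Q a b L s \<longleftrightarrow> s ''u'' 0 = a div Q \<and> s ''v'' 0 = b div Q \<and> s ''c'' 0 = length L \<and>
     (\<forall>r<5. s ''C'' r = (if r < length L then digit q (a mod Q) (L ! r) else 0)) \<and>
     (\<forall>r<5. s ''D'' r = (if r < length L then digit q (b mod Q) (L ! r) else 0)) \<and>
     (\<forall>r<length L. s ''I'' r = L ! r)"

section \<open>Values of the expressions in the program\<close>

lemma val_dist_exp: "val s (dist_exp a b) = 0 \<longleftrightarrow> val s a = val s b"
  by (auto simp: dist_exp_def)

lemma val_digit_exp: "val s (digit_exp r) = digit (s ''n'' 0) (s ''z'' 0) r"
  by (simp add: digit_exp_def digit_def)

lemma val_base_exp: "val s base_exp = base (s ''n'' 0) (s ''k'' 0) (s ''q'' 0)"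
  by (simp add: base_exp_def base_def bound_exp_def bound_def)

lemma val_size_exp:
  assumes "s ''Q'' 0 = s ''q'' 0 ^ s ''k'' 0" "s ''M'' 0 = base (s ''n'' 0) (s ''k'' 0) (s ''q'' 0)"
  shows "val s size_exp = num_verts (s ''n'' 0) (s ''k'' 0) (s ''q'' 0)"
  using assms by (simp add: size_exp_def num_verts_def range_size_def bound_exp_def bound_def)

lemma val_sidon_exp: "val s (sidon_exp p) = sidon (s ''M'' 0) (val s p)"
  by (simp add: sidon_exp_def sidon_def)

lemma val_shift_exp:
  assumes "\<And>r. r < 5 \<Longrightarrow> s x r = (if r < length L then digit q a (L ! r) else 0)"
    and "\<And>r. r < length L \<Longrightarrow> s ''I'' r = L ! r"
  shows "val s (shift_exp x) = shift (s ''n'' 0) (s ''M'' 0) q L a (s ''z'' 0)"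
  unfolding shift_exp_def shift_def val_sum_exp
  using assms by (intro sum.cong) (auto simp: val_digit_exp val_sidon_exp)

lemma matrix_edge_iff:
  assumes "i < fst G" "j < fst G"
  shows "matrix G (i * fst G + j) = (if {i, j} \<in> edges G then 2 else 1)"
  using assms by (simp add: matrix_def)

text \<open>The bound on \<open>''z''\<close> implies that \<open>G\<close> has a vertex; hence the
  guessed digits are vertices and the matrix is read inside its range.\<close>

lemma val_witness_exp:
  assumes r: "ready G k q s"
    and sc: "scanned q (q ^ k) a b (diff_list k q (a mod q ^ k) (b mod q ^ k)) s"
    and z: "s ''z'' 0 < fst G ^ 5" and ne: "s ''c'' 0 \<noteq> 0"
  shows "val s witness_exp \<noteq> 0 \<longleftrightarrow> witness G k q a b (s ''z'' 0)"
proof -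
  define L where "L = diff_list k q (a mod q ^ k) (b mod q ^ k)"
  let ?n = "fst G" and ?z = "s ''z'' 0" and ?M = "base (fst G) k q"
  have n: "?n > 0" using z by (cases "fst G") auto
  note sc = sc[folded L_def, unfolded scanned_def]
  have C: "val s (shift_exp ''C'') = shift ?n ?M q L (a mod q ^ k) ?z"
    using val_shift_exp[of s "''C''" L q "a mod q ^ k"] sc r by (simp add: ready_def)
  have D: "val s (shift_exp ''D'') = shift ?n ?M q L (b mod q ^ k) ?z"
    using val_shift_exp[of s "''D''" L q "b mod q ^ k"] sc r by (simp add: ready_def)
  have lt: "digit ?n ?z 0 < ?n" "digit ?n ?z 1 < ?n" using n by simp_all
  have "digit ?n ?z 0 * ?n + digit ?n ?z 1 < Suc (digit ?n ?z 0) * ?n" using lt by simp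
  also have "\<dots> \<le> ?n * ?n" using Suc_leI[OF lt(1)] by (rule mult_le_mono1)
  finally have G: "s ''G'' (digit ?n ?z 0 * ?n + digit ?n ?z 1) =
      (if {digit ?n ?z 0, digit ?n ?z 1} \<in> edges G then 2 else 1)"
    using r matrix_edge_iff[OF lt] by (simp add: ready_def)
  have "val s witness_exp \<noteq> 0 \<longleftrightarrow>
      val s (dist_exp (Add (var ''u'') (shift_exp ''D'')) (Add (var ''v'') (shift_exp ''C''))) = 0 \<and>
      (s ''c'' 0 < 2 \<or> s ''G'' (digit ?n ?z 0 * ?n + digit ?n ?z 1) > 1)"
    using r by (auto simp: witness_exp_def val_digit_exp ready_def)
  also have "\<dots> \<longleftrightarrow>
      a div q ^ k + shift ?n ?M q L (b mod q ^ k) ?z = b div q ^ k + shift ?n ?M q L (a mod q ^ k) ?z \<and>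
      (length L < 2 \<or> {digit ?n ?z 0, digit ?n ?z 1} \<in> edges G)"
    unfolding G val_dist_exp using sc by (simp add: C D)
  finally show ?thesis
    unfolding witness_def Let_def L_def[symmetric] by (auto simp: not_le)
qed

section \<open>Verification of the program, phase by phase\<close>

lemma wp_setup:
  assumes bnd: "bounded_by V s" and V: "k \<le> V" "base (fst G) k q \<le> V" "num_verts (fst G) k q \<le> V"
    "q ^ k \<le> V" and q: "q \<ge> 1"
    and s: "s ''n'' 0 = fst G" "s ''k'' 0 = k" "s ''q'' 0 = q"
    "\<forall>i < fst G * fst G. s ''G'' i = matrix G i"
  shows "wp V setup_prog (ready G k q) s"
  unfolding setup_prog_def
proof (intro wp_Seq wp_Assign bnd)
  let ?s = "put ''Q'' (val s (Num 0)) (val s (Num 1)) s"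
  let ?I = "\<lambda>j s'. s' ''Q'' 0 = q ^ j \<and> (\<forall>x. x \<notin> {''Q'', ''i''} \<longrightarrow> s' x = s x)"
  have "q ^ k \<ge> 1" using q by simp
  then show V1: "val s (Num 1) \<le> V" using V(4) by simp
  show "wp V (For ''i'' (var ''k'') (''Q'' ::= Mul (var ''Q'') (var ''q'')))
      (wp V (''M'' ::= base_exp ;; ''m'' ::= size_exp) (ready G k q)) ?s"
  proof (rule wp_For[where I = ?I and N = k])
    show "bounded_by V ?s" using bnd V1 by (rule bounded_by_put)
    show "?I 0 (put ''i'' 0 0 ?s)" by simp
    show "val s' (var ''k'') = k" if "?I j s'" for j s' using that s by simp
    show "wp V (''Q'' ::= Mul (var ''Q'') (var ''q''))
        (\<lambda>s'. s' ''i'' 0 = j \<and> ?I (Suc j) (put ''i'' 0 (Suc j) s')) s'"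
      if j: "j < k" "?I j s'" "bounded_by V s'" "s' ''i'' 0 = j" for j s'
    proof (rule wp_Assign[OF j(3)])
      have "q * q ^ j \<le> q ^ k" using q j(1) power_increasing[of "Suc j" k q] by simp
      then show "val s' (Mul (var ''Q'') (var ''q'')) \<le> V" using j(2) s V(4) by (simp add: mult.commute)
    qed (use j s in \<open>simp add: mult.commute\<close>)
    fix s' assume I: "?I k s'" and b: "bounded_by V s'"
    show "wp V (''M'' ::= base_exp ;; ''m'' ::= size_exp) (ready G k q) s'"
      using V I s b
      by (intro wp_Seq wp_Assign bounded_by_put)
        (simp_all add: val_base_exp val_size_exp ready_def)
  qed (rule V(1))
qed

lemma wp_split:
  assumes bnd: "bounded_by V s" and V: "V \<ge> 5" and r: "ready G k q s" and e: "s ''e'' 0 = e"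
    and a: "a = e div num_verts (fst G) k q" and b: "b = e mod num_verts (fst G) k q"
  shows "wp V split_prog (\<lambda>s'. s' ''x'' 0 = a mod q ^ k \<and> s' ''y'' 0 = b mod q ^ k \<and>
    scanned q (q ^ k) a b [] s' \<and>
    (\<forall>x. x \<notin> {''x'', ''y'', ''u'', ''v'', ''c'', ''C'', ''D'', ''r''} \<longrightarrow> s' x = s x)) s"
    (is "wp V _ ?R s")
proof -
  let ?P = "\<lambda>s'. s' ''x'' 0 = a mod q ^ k \<and> s' ''y'' 0 = b mod q ^ k \<and>
    s' ''u'' 0 = a div q ^ k \<and> s' ''v'' 0 = b div q ^ k \<and> s' ''c'' 0 = 0 \<and>
    (\<forall>x. x \<notin> {''x'', ''y'', ''u'', ''v'', ''c'', ''C'', ''D'', ''r''} \<longrightarrow> s' x = s x)"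
  have eV: "e \<le> V" using bounded_byD[OF bnd, of "''e''" 0] e by simp
  have le: "a mod q ^ k \<le> V" "a div q ^ k \<le> V" "b mod q ^ k \<le> V" "b div q ^ k \<le> V"
    unfolding a b by (meson eV le_trans div_le_dividend mod_less_eq_dividend)+
  have loop: "wp V (For ''r'' (Num 5) (Assign ''C'' (var ''r'') (Num 0) ;; Assign ''D'' (var ''r'') (Num 0)))
      ?R s'" if s': "bounded_by V s'" "?P s'" for s'
  proof (rule wp_For[where I = "\<lambda>j s'. ?P s' \<and> (\<forall>r<j. s' ''C'' r = 0 \<and> s' ''D'' r = 0)" and N = 5])
    fix j s' assume "?P s' \<and> (\<forall>r<j. s' ''C'' r = 0 \<and> s' ''D'' r = 0)"
      and "bounded_by V s'" "s' ''r'' 0 = j"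
    then show "wp V (Assign ''C'' (var ''r'') (Num 0) ;; Assign ''D'' (var ''r'') (Num 0))
        (\<lambda>s'. s' ''r'' 0 = j \<and> ?P (put ''r'' 0 (Suc j) s') \<and>
          (\<forall>r<Suc j. (put ''r'' 0 (Suc j) s') ''C'' r = 0 \<and> (put ''r'' 0 (Suc j) s') ''D'' r = 0)) s'"
      by (intro wp_Seq wp_Assign bounded_by_put) (auto simp: less_Suc_eq)
  qed (use s' V in \<open>auto simp: scanned_def\<close>)
  show ?thesis
    unfolding split_prog_def
    by (intro wp_Seq wp_Assign bounded_by_put bnd loop)
      (use r e le in \<open>simp_all add: ready_def a[symmetric] b[symmetric]\<close>)
qed

lemma diff_list_Suc:
  "diff_list (Suc j) q a b = diff_list j q a b @ (if digit q a j = digit q b j then [] else [j])"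
  by (simp add: diff_list_def)

lemma scanned_snoc:
  assumes "scanned q Q a b L s"
  shows "scanned q Q a b (L @ [j])
    (put ''c'' 0 (Suc (length L)) (put ''I'' (length L) j
      (put ''D'' (length L) (digit q (b mod Q) j) (put ''C'' (length L) (digit q (a mod Q) j) s))))"
  using assms by (auto simp: scanned_def nth_append less_Suc_eq)

text \<open>After \<open>j\<close> rounds the points have been divided by \<open>q ^ j\<close>, so
  the remainder modulo \<open>q\<close> is digit \<open>j\<close>.\<close>

lemma wp_scan:
  assumes bnd: "bounded_by V s" and V: "k \<le> V" and s: "s ''k'' 0 = k" "s ''q'' 0 = q"
    "s ''x'' 0 = a mod Q" "s ''y'' 0 = b mod Q" "scanned q Q a b [] s"
  shows "wp V scan_prog (\<lambda>s'. scanned q Q a b (diff_list k q (a mod Q) (b mod Q)) s' \<and>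
    (\<forall>x. x \<notin> {''x'', ''y'', ''c'', ''C'', ''D'', ''I'', ''i''} \<longrightarrow> s' x = s x)) s"
  unfolding scan_prog_def
proof -
  let ?L = "\<lambda>j. diff_list j q (a mod Q) (b mod Q)"
  let ?F = "\<lambda>s'. \<forall>x. x \<notin> {''x'', ''y'', ''c'', ''C'', ''D'', ''I'', ''i''} \<longrightarrow> s' x = s x"
  let ?I = "\<lambda>j s'. scanned q Q a b (?L j) s' \<and> s' ''x'' 0 = a mod Q div q ^ j \<and>
    s' ''y'' 0 = b mod Q div q ^ j \<and> ?F s'"
  let ?c1 = "IfNZ (dist_exp (mod_exp (var ''x'') (var ''q'')) (mod_exp (var ''y'') (var ''q'')))
        (Assign ''C'' (var ''c'') (mod_exp (var ''x'') (var ''q'')) ;;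
         Assign ''D'' (var ''c'') (mod_exp (var ''y'') (var ''q'')) ;;
         Assign ''I'' (var ''c'') (var ''i'') ;;
         ''c'' ::= Add (var ''c'') (Num 1))
        Skip"
  show "wp V (For ''i'' (var ''k'') (?c1 ;; ''x'' ::= Div (var ''x'') (var ''q'') ;;
      ''y'' ::= Div (var ''y'') (var ''q''))) (\<lambda>s'. scanned q Q a b (?L k) s' \<and> ?F s') s"
  proof (rule wp_For[where I = ?I and N = k])
    show "?I 0 (put ''i'' 0 0 s)"
      using s by (auto simp: diff_list_def scanned_def)
    fix j s' assume j: "j < k" and I: "?I j s'" and b': "bounded_by V s'" and i: "s' ''i'' 0 = j"
    let ?J = "\<lambda>s''. scanned q Q a b (?L (Suc j)) s'' \<and> s'' ''x'' 0 = a mod Q div q ^ j \<and>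
      s'' ''y'' 0 = b mod Q div q ^ j \<and> s'' ''i'' 0 = j \<and> ?F s''"
    \<comment> \<open>Keeps the counter \<open>''c''\<close> within \<open>V\<close>: after this
      round it is at most \<open>j + 1 \<le> k\<close>.\<close>
    have len: "length (?L j) \<le> j" unfolding diff_list_def by (rule order.trans[OF length_filter_le]) simp
    have q': "s' ''q'' 0 = q" using I s by simp
    have xy: "s' ''x'' 0 mod q = digit q (a mod Q) j" "s' ''y'' 0 mod q = digit q (b mod Q) j"
      using I by (simp_all add: digit_def)
    have c: "s' ''c'' 0 = length (?L j)" using I by (simp add: scanned_def)
    have dV: "digit q (a mod Q) j \<le> V" "digit q (b mod Q) j \<le> V"
      unfolding xy[symmetric] by (meson bounded_byD[OF b'] le_trans mod_less_eq_dividend)+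
    have c1: "wp V ?c1 ?J s'"
    proof (rule wp_IfNZ[OF b'])
      assume "val s' (dist_exp (mod_exp (var ''x'') (var ''q'')) (mod_exp (var ''y'') (var ''q''))) \<noteq> 0"
      then have ne: "?L (Suc j) = ?L j @ [j]"
        by (simp add: val_dist_exp xy q' diff_list_Suc)
      show "wp V (Assign ''C'' (var ''c'') (mod_exp (var ''x'') (var ''q'')) ;;
         Assign ''D'' (var ''c'') (mod_exp (var ''y'') (var ''q'')) ;;
         Assign ''I'' (var ''c'') (var ''i'') ;;
         ''c'' ::= Add (var ''c'') (Num 1)) ?J s'"
        using scanned_snoc[of q Q a b "?L j" s' j] I len j V dV b'
        by (intro wp_Seq wp_Assign bounded_by_put)
          (simp_all add: ne xy q' c i s digit_def[symmetric])
    next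
      assume "val s' (dist_exp (mod_exp (var ''x'') (var ''q'')) (mod_exp (var ''y'') (var ''q''))) = 0"
      then show "wp V Skip ?J s'"
        using I i b' by (intro wp_Skip) (simp_all add: val_dist_exp xy q' diff_list_Suc s digit_def[symmetric])
    qed
    show "wp V (?c1 ;; ''x'' ::= Div (var ''x'') (var ''q'') ;; ''y'' ::= Div (var ''y'') (var ''q''))
        (\<lambda>s'. s' ''i'' 0 = j \<and> ?I (Suc j) (put ''i'' 0 (Suc j) s')) s'"
    proof (rule wp_Seq, rule wp_mono[OF c1])
      fix s'' assume b'': "bounded_by V s''" and J: "?J s''"
      have "s'' ''x'' 0 div q \<le> V" "s'' ''y'' 0 div q \<le> V"
        by (meson bounded_byD[OF b''] le_trans div_le_dividend)+
      then show "wp V (''x'' ::= Div (var ''x'') (var ''q'') ;; ''y'' ::= Div (var ''y'') (var ''q''))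
          (\<lambda>s'. s' ''i'' 0 = j \<and> ?I (Suc j) (put ''i'' 0 (Suc j) s')) s''"
        using J s b'' by (intro wp_Seq wp_Assign bounded_by_put)
          (simp_all add: scanned_def div_mult2_eq[symmetric] mult.commute)
    qed
  qed (use bnd V s in auto)
qed

lemma wp_search:
  assumes bnd: "bounded_by V s" and V: "fst G ^ 5 \<le> V" "2 \<le> V" and r: "ready G k q s"
    and sc: "scanned q (q ^ k) a b (diff_list k q (a mod q ^ k) (b mod q ^ k)) s"
    and c: "s ''c'' 0 \<noteq> 0" and f: "s ''f'' 0 = 1"
  shows "wp V search_prog (\<lambda>s'. s' ''f'' 0 = (if \<exists>z<fst G ^ 5. witness G k q a b z then 2 else 1) \<and>
    (\<forall>x. x \<notin> {''z'', ''f''} \<longrightarrow> s' x = s x)) s"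
  unfolding search_prog_def
proof -
  let ?I = "\<lambda>j s'. s' ''f'' 0 = (if \<exists>z<j. witness G k q a b z then 2 else 1) \<and>
    (\<forall>x. x \<notin> {''z'', ''f''} \<longrightarrow> s' x = s x)"
  show "wp V (For ''z'' (pow_exp (var ''n'') 5) (IfNZ witness_exp (''f'' ::= Num 2) Skip)) (?I (fst G ^ 5)) s"
  proof (rule wp_For[where I = ?I and N = "fst G ^ 5"])
    fix j s' assume j: "j < fst G ^ 5" and I: "?I j s'" and b': "bounded_by V s'" and z: "s' ''z'' 0 = j"
    have "ready G k q s'" using r I by (simp add: ready_def)
    moreover have "scanned q (q ^ k) a b (diff_list k q (a mod q ^ k) (b mod q ^ k)) s'"
      using sc I by (simp add: scanned_def)
    ultimately have w: "val s' witness_exp \<noteq> 0 \<longleftrightarrow> witness G k q a b j"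
      using val_witness_exp[of G k q s' a b] j z c I by simp
    show "wp V (IfNZ witness_exp (''f'' ::= Num 2) Skip)
        (\<lambda>s'. s' ''z'' 0 = j \<and> ?I (Suc j) (put ''z'' 0 (Suc j) s')) s'"
      using w I z b' V by (intro wp_IfNZ wp_Assign wp_Skip) (auto simp: less_Suc_eq)
  qed (use bnd V r f in \<open>auto simp: ready_def\<close>)
qed

text \<open>The branches mirror \<open>adjacent\<close>: equal points, more than five differing
  coordinates, or a search for a witness.\<close>

lemma wp_entry:
  assumes bnd: "bounded_by V s" and V: "fst G ^ 5 \<le> V" "5 \<le> V" "k \<le> V" and r: "ready G k q s"
    and e: "s ''e'' 0 = e" "e < num_verts (fst G) k q * num_verts (fst G) k q"
  shows "wp V entry_prog (\<lambda>s'. s' ''H'' = (s ''H'')(e := matrix (gap_graph G k q) e) \<and>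
    (\<forall>x. x \<notin> {''x'', ''y'', ''u'', ''v'', ''c'', ''C'', ''D'', ''r'', ''I'', ''i'', ''f'', ''z'', ''H''} \<longrightarrow>
      s' x = s x)) s"
    (is "wp V _ ?R s")
proof -
  define a b where "a = e div num_verts (fst G) k q" and "b = e mod num_verts (fst G) k q"
  \<comment> \<open>The bound on \<open>e\<close> makes the number of vertices positive, which the
    remainder \<open>b\<close> needs.\<close>
  have less: "a < num_verts (fst G) k q" "b < num_verts (fst G) k q"
    using e(2) by (auto simp: a_def b_def less_mult_imp_div_less)
      (metis mod_less_divisor mult_is_0 neq0_conv not_less0)
  define L where "L = diff_list k q (a mod q ^ k) (b mod q ^ k)"
  have matrix: "matrix (gap_graph G k q) e = (if adjacent G k q a b then 2 else 1)"
    using edges_gap_graph_iff[OF less] by (simp add: matrix_def a_def b_def)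
  let ?F = "\<lambda>s'. \<forall>x. x \<notin> {''x'', ''y'', ''u'', ''v'', ''c'', ''C'', ''D'', ''r'', ''I'', ''i'', ''f'', ''z''} \<longrightarrow>
    s' x = s x"
  have finish: "wp V (Assign ''H'' (var ''e'') (var ''f'')) ?R s'"
    if "bounded_by V s'" "s' ''f'' 0 = (if adjacent G k q a b then 2 else 1)" "?F s'" for s'
    using that e V by (intro wp_Assign) (auto simp: matrix)
  have decide: "wp V (''f'' ::= Num 1 ;;
      IfNZ (var ''c'') (IfNZ (Sub (var ''c'') (Num 5)) (''f'' ::= Num 2) search_prog) Skip ;;
      Assign ''H'' (var ''e'') (var ''f'')) ?R s'"
    if s': "bounded_by V s'" "scanned q (q ^ k) a b L s'" "?F s'" for s'
  proof -
    let ?s = "put ''f'' 0 1 s'"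
    have b: "bounded_by V ?s" using s' V by simp
    have c: "?s ''c'' 0 = length L" using s' by (simp add: scanned_def)
    have branch: "wp V (IfNZ (var ''c'') (IfNZ (Sub (var ''c'') (Num 5)) (''f'' ::= Num 2) search_prog) Skip)
        (\<lambda>s'. s' ''f'' 0 = (if adjacent G k q a b then 2 else 1) \<and> ?F s') ?s"
    proof (intro wp_IfNZ b)
      assume ne: "val ?s (var ''c'') \<noteq> 0" and "val ?s (Sub (var ''c'') (Num 5)) \<noteq> 0"
      then have "adjacent G k q a b" using c by (auto simp: adjacent_def Let_def L_def)
      then show "wp V (''f'' ::= Num 2)
          (\<lambda>s'. s' ''f'' 0 = (if adjacent G k q a b then 2 else 1) \<and> ?F s') ?s"
        using b V s' by (intro wp_Assign) auto
    next
      assume ne: "val ?s (var ''c'') \<noteq> 0" and "val ?s (Sub (var ''c'') (Num 5)) = 0"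
      then have adj: "adjacent G k q a b \<longleftrightarrow> (\<exists>z<fst G ^ 5. witness G k q a b z)"
        using c by (auto simp: adjacent_def Let_def L_def)
      have "ready G k q ?s" using r s' by (simp add: ready_def)
      moreover have "scanned q (q ^ k) a b (diff_list k q (a mod q ^ k) (b mod q ^ k)) ?s"
        using s' by (simp add: scanned_def L_def)
      ultimately show "wp V search_prog
          (\<lambda>s'. s' ''f'' 0 = (if adjacent G k q a b then 2 else 1) \<and> ?F s') ?s"
        using V ne s'(3)
        by (intro wp_mono[OF wp_search[OF b V(1), of k q a b]]) (auto simp: adj)
    next
      assume "val ?s (var ''c'') = 0"
      then have "\<not> adjacent G k q a b" using c by (auto simp: adjacent_def Let_def L_def)
      then show "wp V Skip (\<lambda>s'. s' ''f'' 0 = (if adjacent G k q a b then 2 else 1) \<and> ?F s') ?s"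
        using b s' by (intro wp_Skip) auto
    qed
    have "wp V (IfNZ (var ''c'') (IfNZ (Sub (var ''c'') (Num 5)) (''f'' ::= Num 2) search_prog) Skip ;;
        Assign ''H'' (var ''e'') (var ''f'')) ?R ?s"
      by (rule wp_Seq, rule wp_mono[OF branch], rule finish) (elim conjE, assumption)+
    then show ?thesis
      by - (rule wp_Seq, rule wp_Assign[OF s'(1)], use V in simp_all)
  qed
  show ?thesis
    unfolding entry_prog_def
  proof (rule wp_Seq, rule wp_mono[OF wp_split[OF bnd V(2) r e(1) a_def b_def]], rule wp_Seq)
    fix s1 assume b1: "bounded_by V s1" and 1: "s1 ''x'' 0 = a mod q ^ k \<and> s1 ''y'' 0 = b mod q ^ k \<and>
      scanned q (q ^ k) a b [] s1 \<and>
      (\<forall>x. x \<notin> {''x'', ''y'', ''u'', ''v'', ''c'', ''C'', ''D'', ''r''} \<longrightarrow> s1 x = s x)"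
    have "wp V scan_prog (\<lambda>s'. scanned q (q ^ k) a b L s' \<and>
        (\<forall>x. x \<notin> {''x'', ''y'', ''c'', ''C'', ''D'', ''I'', ''i''} \<longrightarrow> s' x = s1 x)) s1"
      unfolding L_def using r 1 by (intro wp_scan[OF b1 V(3)]) (auto simp: ready_def)
    then show "wp V scan_prog (wp V (''f'' ::= Num 1 ;;
      IfNZ (var ''c'') (IfNZ (Sub (var ''c'') (Num 5)) (''f'' ::= Num 2) search_prog) Skip ;;
      Assign ''H'' (var ''e'') (var ''f'')) ?R) s1"
    proof (rule wp_mono)
      fix s2 assume b2: "bounded_by V s2" and 2: "scanned q (q ^ k) a b L s2 \<and>
        (\<forall>x. x \<notin> {''x'', ''y'', ''c'', ''C'', ''D'', ''I'', ''i''} \<longrightarrow> s2 x = s1 x)"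
      have "?F s2" using 1 2 by simp
      then show "wp V (''f'' ::= Num 1 ;;
          IfNZ (var ''c'') (IfNZ (Sub (var ''c'') (Num 5)) (''f'' ::= Num 2) search_prog) Skip ;;
          Assign ''H'' (var ''e'') (var ''f'')) ?R s2"
        by (rule decide[OF b2 conjunct1[OF 2]])
    qed
  qed
qed

lemma wp_reduction:
  assumes bnd: "bounded_by V s" and V: "fst G ^ 5 \<le> V" "5 \<le> V" "k \<le> V" "base (fst G) k q \<le> V"
    "num_verts (fst G) k q * num_verts (fst G) k q \<le> V" "q ^ k \<le> V" and q: "q \<ge> 1"
    and s: "s ''n'' 0 = fst G" "s ''k'' 0 = k" "s ''q'' 0 = q"
    "\<forall>i < fst G * fst G. s ''G'' i = matrix G i"
  shows "wp V reduction (\<lambda>s'. outputs s' (gap_graph G k q)) s"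
proof -
  let ?m = "num_verts (fst G) k q"
  let ?I = "\<lambda>j s'. ready G k q s' \<and> (\<forall>i<j. s' ''H'' i = matrix (gap_graph G k q) i)"
  have m: "?m \<le> V" using V(5) le_square le_trans by blast
  show ?thesis
    unfolding reduction_def
  proof (rule wp_Seq, rule wp_mono[OF wp_setup[OF bnd V(3,4) m V(6) q s]])
    fix s' assume b: "bounded_by V s'" and r: "ready G k q s'"
    show "wp V (For ''e'' (Mul (var ''m'') (var ''m'')) entry_prog) (\<lambda>s'. outputs s' (gap_graph G k q)) s'"
    proof (rule wp_For[where I = ?I and N = "?m * ?m"])
      fix j s' assume j: "j < ?m * ?m" and I: "?I j s'" and b': "bounded_by V s'" and e: "s' ''e'' 0 = j"
      show "wp V entry_prog (\<lambda>s'. s' ''e'' 0 = j \<and> ?I (Suc j) (put ''e'' 0 (Suc j) s')) s'"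
        using I by (intro wp_mono[OF wp_entry[OF b' V(1-3) _ e j]])
          (auto simp: ready_def e less_Suc_eq)
    qed (use b r V in \<open>auto simp: ready_def outputs_def\<close>)
  qed
qed

text \<open>The formula for \<open>num_verts\<close> with \<open>n\<close>, \<open>k\<close>,
  \<open>q\<close> and \<open>q ^ k\<close> all replaced by the common bound
  \<open>X\<close>.\<close>

definition size_poly :: "nat poly" where
  "size_poly = (let X = [:0, 1:]; N = X * X + 1; M = [:16:] * X * N ^ 15 in
     X * (X * X * ([:15:] * (M * N) ^ 15) + 1))"

text \<open>The summands dominate the number of output entries, \<open>base\<close>, the number of
  guesses, the input parameters and the constant loop count.\<close>

definition cell_poly :: "nat poly" where
  "cell_poly = (let X = [:0, 1:] in
     size_poly * size_poly + [:16:] * X * (X * X + 1) ^ 15 + X ^ 5 + X + [:5:])"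

theorem theorem3:
  shows "\<exists>(R :: com) (P :: nat poly) (H :: graph \<Rightarrow> nat \<Rightarrow> nat \<Rightarrow> graph).
    \<forall>(G :: graph) (k :: nat) (q :: nat). is_graph G \<and> k \<ge> 1 \<and> primepow q \<longrightarrow>
      is_graph (H G k q) \<and>
      (\<exists>t s. exec R (input G k q) t s \<and> outputs s (H G k q) \<and>
             t \<le> poly P (card (verts G) + q ^ k)) \<and>
      (has_clique G k \<longrightarrow> has_clique (H G k q) (q ^ k)) \<and>
      (\<not> has_clique G k \<longrightarrow> \<not> has_clique (H G k q) (q ^ (k - 1) + 1))"
proof (intro exI allI impI, elim conjE)
  fix G :: graph and k q :: nat
  assume G: "is_graph G" and k: "k \<ge> 1" and "primepow q"
  then have q2: "q > 1" using primepow_gt_Suc_0[of q] by simp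
  then have q: "q \<ge> 1" by simp
  define X where "X = card (verts G) + q ^ k"
  let ?V = "poly cell_poly X"
  have n: "fst G \<le> X" and Q: "q ^ k \<le> X" by (simp_all add: X_def verts_def)
  \<comment> \<open>The size parameter does not contain \<open>k\<close> itself; since
    \<open>q \<ge> 2\<close>, it is dominated through \<open>k < 2 ^ k \<le> q ^ k\<close>.\<close>
  have kX: "k \<le> X" using q2 Q less_exp[of k] power_mono[of 2 q k] by linarith
  have qX: "q \<le> X" using Q self_le_power[of q k] q k by simp
  have N: "bound (fst G) k \<le> X * X + 1" using n kX by (simp add: bound_def mult_le_mono)
  then have M: "base (fst G) k q \<le> 16 * X * (X * X + 1) ^ 15"
    using qX unfolding base_def by (intro mult_le_mono power_mono) auto
  have m: "num_verts (fst G) k q \<le> poly size_poly X"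
  proof -
    have "num_verts (fst G) k q \<le> X * (X * X * (15 * (16 * X * (X * X + 1) ^ 15 * (X * X + 1)) ^ 15) + 1)"
      unfolding num_verts_def range_size_def
      by (intro mult_le_mono add_mono power_mono Q kX qX M N order.refl) simp
    then show ?thesis by (simp add: size_poly_def Let_def mult_ac)
  qed
  have bnd: "bounded_by ?V (input G k q)"
    using n kX qX by (auto simp: bounded_by_def input_def matrix_def cell_poly_def Let_def)
  have "fst G ^ 5 \<le> X ^ 5" using n by (intro power_mono) simp_all
  then have n5: "fst G ^ 5 \<le> ?V" by (rule order.trans) (simp add: cell_poly_def Let_def)
  have V: "5 \<le> ?V" "k \<le> ?V" "base (fst G) k q \<le> ?V"
    "num_verts (fst G) k q * num_verts (fst G) k q \<le> ?V" "q ^ k \<le> ?V"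
    using kX M mult_le_mono[OF m m] Q
    by (auto simp: cell_poly_def Let_def)
  have "wp ?V reduction (\<lambda>s. outputs s (gap_graph G k q)) (input G k q)"
    by (rule wp_reduction[OF bnd n5 V q]) (auto simp: input_def)
  then obtain t s where "exec reduction (input G k q) t s" "t \<le> poly (time_poly reduction) ?V"
    "outputs s (gap_graph G k q)" by (rule wpE)
  \<comment> \<open>The bound on cells and loop counts is itself polynomial in the size, so
    composing the two polynomials gives the final one.\<close>
  moreover have "poly (time_poly reduction) ?V = poly (time_poly reduction \<circ>\<^sub>p cell_poly) (card (verts G) + q ^ k)"
    by (simp add: poly_pcompose X_def)
  ultimately show "is_graph (gap_graph G k q) \<and>
      (\<exists>t s. exec reduction (input G k q) t s \<and> outputs s (gap_graph G k q) \<and>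
             t \<le> poly (time_poly reduction \<circ>\<^sub>p cell_poly) (card (verts G) + q ^ k)) \<and>
      (has_clique G k \<longrightarrow> has_clique (gap_graph G k q) (q ^ k)) \<and>
      (\<not> has_clique G k \<longrightarrow> \<not> has_clique (gap_graph G k q) (q ^ (k - 1) + 1))"
    using is_graph_gap_graph gap_graph_complete[OF k q] gap_graph_sound[OF G k q] by metis
qed

end
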